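(* Let $K$ be a complete discretely valued field with ring of integers $\mathcal{O}_K$, uniformiser $\pi$ and residue field of characteristic not equal to $2$. Let $G$ be a compact group and $\rho\colon G\to\mathrm{GL}_2(K)$ a continuous irreducible representation. Let $n\ge1$ and let $\chi_1,\chi_2\colon G\to(\mathcal{O}_K/\pi^n\mathcal{O}_K)^\times$ be characters such that $\operatorname{tr}\rho(g)\equiv\chi_1(g)+\chi_2(g)\pmod{\pi^n}$ for all $g\in G$. Let $m(\chi_1,\chi_2)$ be the largest integer $m\le n$ such that $\chi_1(g)\equiv\chi_2(g)\pmod{\pi^m}$ for all $g\in G$, and define \[s=s(\chi_1,\chi_2)=\begin{cases}n-m(\chi_1,\chi_2)&\text{if } m(\chi_1,\chi_2)<\frac n2,\\ \lceil n/2\rceil&\text{if } m(\chi_1,\chi_2)\ge \frac n2.\end{cases}\] Then there exists a $G$-stable lattice $\Lambda\subset K^2$ such that $\Lambda/\pi^s\Lambda$ is a residually non-split extension of $\chi_1\pmod{\pi^s}$ by $\chi_2\pmod{\pi^s}$.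
   Context: A lattice is a free rank-$2$ $\mathcal{O}_K$-submodule of $K^2$ spanning $K^2$; it is $G$-stable if $\rho(g)\Lambda\subseteq\Lambda$ for all $g$. "$\Lambda/\pi^s\Lambda$ is an extension of $\chi_1$ by $\chi_2$" means that $\Lambda/\pi^s\Lambda$ contains a $G$-stable free rank-$1$ $\mathcal{O}_K/\pi^s\mathcal{O}_K$-submodule on which $G$ acts via $\chi_2 \bmod \pi^s$, with quotient on which $G$ acts via $\chi_1\bmod\pi^s$. "Residually non-split" means that $\Lambda/\pi\Lambda$ is an indecomposable $G$-representation over the residue field. *)

theory Defs
  imports "HOL-Analysis.Analysis" "HOL-Algebra.QuotRing" "HOL-Algebra.Module"
begin

section \<open>Complete discretely valued fields\<close>

text \<open>A normalised discrete valuation is a surjection from the nonzero elements of the field onto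
  the integers. The value \<open>v 0\<close>, morally infinite, is left unspecified and never used.\<close>

locale discrete_valuation =
  fixes v :: "'k::field \<Rightarrow> int"
  assumes v_mult: "\<lbrakk>x \<noteq> 0; y \<noteq> 0\<rbrakk> \<Longrightarrow> v (x * y) = v x + v y"
    and v_add: "\<lbrakk>x \<noteq> 0; y \<noteq> 0; x + y \<noteq> 0\<rbrakk> \<Longrightarrow> min (v x) (v y) \<le> v (x + y)"
    and v_surj: "\<forall>k. \<exists>x. x \<noteq> 0 \<and> v x = k"

definition vdist :: "('k::field \<Rightarrow> int) \<Rightarrow> 'k \<Rightarrow> 'k \<Rightarrow> real" where
  "vdist v x y = (if x = y then 0 else 2 powr - real_of_int (v (x - y)))"

definition valuation_topology :: "('k::field \<Rightarrow> int) \<Rightarrow> 'k topology" where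
  "valuation_topology v = Metric_space.mtopology UNIV (vdist v)"

locale complete_discrete_valuation = discrete_valuation +
  assumes complete: "Metric_space.mcomplete UNIV (vdist v)"

definition uniformiser :: "('k::field \<Rightarrow> int) \<Rightarrow> 'k \<Rightarrow> bool" where
  "uniformiser v p \<longleftrightarrow> p \<noteq> 0 \<and> v p = 1"

definition int_ring :: "('k::field \<Rightarrow> int) \<Rightarrow> 'k ring" where
  "int_ring v = \<lparr>carrier = {x. x = 0 \<or> 0 \<le> v x}, mult = (*), one = 1, zero = 0, add = (+)\<rparr>"

definition pow_ideal :: "('k::field \<Rightarrow> int) \<Rightarrow> 'k \<Rightarrow> nat \<Rightarrow> 'k set" where
  "pow_ideal v p k = PIdl\<^bsub>int_ring v\<^esub> (p ^ k)"

text \<open>The ring of integers modulo the \<open>k\<close>-th power of the uniformiser \<open>p\<close>; its elements are cosets.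
  For \<open>k = 1\<close> it is the residue field.\<close>

definition quot_ring :: "('k::field \<Rightarrow> int) \<Rightarrow> 'k \<Rightarrow> nat \<Rightarrow> 'k set ring" where
  "quot_ring v p k = int_ring v Quot pow_ideal v p k"

text \<open>Reduction to exponent \<open>k\<close> of an element of \<^term>\<open>quot_ring v p n\<close>, for \<open>k \<le> n\<close>: the coset
  of the larger ideal that contains the given coset.\<close>

definition reduce :: "('k::field \<Rightarrow> int) \<Rightarrow> 'k \<Rightarrow> nat \<Rightarrow> 'k set \<Rightarrow> 'k set" where
  "reduce v p k X = pow_ideal v p k <+>\<^bsub>int_ring v\<^esub> X"

definition ring_char :: "('a, 'b) ring_scheme \<Rightarrow> nat" where
  "ring_char R =
    (if \<exists>k::nat. 0 < k \<and> [k] \<cdot>\<^bsub>R\<^esub> \<one>\<^bsub>R\<^esub> = \<zero>\<^bsub>R\<^esub>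
     then LEAST k::nat. 0 < k \<and> [k] \<cdot>\<^bsub>R\<^esub> \<one>\<^bsub>R\<^esub> = \<zero>\<^bsub>R\<^esub> else 0)"


section \<open>Compact groups and two-dimensional representations\<close>

text \<open>No separation axiom is imposed.\<close>

locale compact_group = group G for G :: "('g, 'b) monoid_scheme" (structure) +
  fixes T :: "'g topology"
  assumes topspace_eq: "topspace T = carrier G"
    and continuous_mult: "continuous_map (prod_topology T T) T (\<lambda>(x, y). x \<otimes> y)"
    and continuous_inv: "continuous_map T T (\<lambda>x. inv x)"
    and compact: "compact_space T"

definition GL2 :: "('k::field ^ 2 ^ 2) monoid" where
  "GL2 = \<lparr>carrier = {A. invertible A}, mult = (**), one = mat 1\<rparr>"

text \<open>The topology induced from the product topology on the four matrix entries. As inversion is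
  continuous on the unit group of a topological field, it is also the group topology.\<close>

definition GL2_topology :: "('k::field \<Rightarrow> int) \<Rightarrow> ('k ^ 2 ^ 2) topology" where
  "GL2_topology v = pullback_topology (carrier GL2) (\<lambda>A (i, j). A $ i $ j)
     (product_topology (\<lambda>_. valuation_topology v) UNIV)"

definition irreducible_rep ::
    "('g, 'b) monoid_scheme \<Rightarrow> ('g \<Rightarrow> 'k::field ^ 2 ^ 2) \<Rightarrow> bool" where
  "irreducible_rep G \<rho> \<longleftrightarrow>
    (\<forall>W. vec.subspace W \<and> (\<forall>g\<in>carrier G. \<forall>w\<in>W. \<rho> g *v w \<in> W) \<longrightarrow> W = {0} \<or> W = UNIV)"


section \<open>Modules with a group action\<close>

text \<open>A module of rank \<open>r\<close> is free if some \<open>r\<close>-element set \<open>B\<close> is a basis: each element is a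
  linear combination of \<open>B\<close> in exactly one way.\<close>

definition free_of_rank :: "('a, 'c) ring_scheme \<Rightarrow> ('a, 'm, 'd) module_scheme \<Rightarrow> nat \<Rightarrow> bool" where
  "free_of_rank R M r \<longleftrightarrow>
    (\<exists>B. finite B \<and> card B = r \<and> B \<subseteq> carrier M \<and>
      (\<forall>x\<in>carrier M. \<exists>!c. c \<in> B \<rightarrow>\<^sub>E carrier R \<and>
         x = finsum M (\<lambda>b. c b \<odot>\<^bsub>M\<^esub> b) B))"

text \<open>The quotient of a module by a submodule \<open>N\<close>, with scalars in a quotient of the ring by an
  ideal that multiplies the module into \<open>N\<close>. Scalars and vectors are both cosets, and their product
  is formed as in \<^const>\<open>FactRing\<close>. The fields for multiplication and one carry no meaning in
  a module.\<close>

definition fact_module :: "('a, 'm, 'd) module_scheme \<Rightarrow> 'm set \<Rightarrow> ('a set, 'm set) module" where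
  "fact_module M N =
    \<lparr>carrier = a_rcosets\<^bsub>M\<^esub> N, mult = undefined, one = undefined, zero = N, add = set_add M,
     smult = (\<lambda>A X. \<Union>a\<in>A. \<Union>x\<in>X. N +>\<^bsub>M\<^esub> (a \<odot>\<^bsub>M\<^esub> x))\<rparr>"

definition stable_submodule ::
    "('a, 'c) ring_scheme \<Rightarrow> ('a, 'm, 'd) module_scheme \<Rightarrow> ('g, 'b) monoid_scheme \<Rightarrow>
      ('g \<Rightarrow> 'm \<Rightarrow> 'm) \<Rightarrow> 'm set \<Rightarrow> bool" where
  "stable_submodule R M G act W \<longleftrightarrow>
    submodule W R M \<and> (\<forall>g\<in>carrier G. \<forall>x\<in>W. act g x \<in> W)"

definition indecomposable ::
    "('a, 'c) ring_scheme \<Rightarrow> ('a, 'm, 'd) module_scheme \<Rightarrow> ('g, 'b) monoid_scheme \<Rightarrow>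
      ('g \<Rightarrow> 'm \<Rightarrow> 'm) \<Rightarrow> bool" where
  "indecomposable R M G act \<longleftrightarrow>
    carrier M \<noteq> {\<zero>\<^bsub>M\<^esub>} \<and>
    (\<forall>U W. stable_submodule R M G act U \<and> stable_submodule R M G act W \<and>
       U \<inter> W = {\<zero>\<^bsub>M\<^esub>} \<and> U <+>\<^bsub>M\<^esub> W = carrier M \<longrightarrow> U = {\<zero>\<^bsub>M\<^esub>} \<or> W = {\<zero>\<^bsub>M\<^esub>})"

text \<open>\<open>M\<close> is an extension of \<open>\<psi>\<^sub>1\<close> (the quotient) by \<open>\<psi>\<^sub>2\<close> (the submodule \<open>W\<close>).\<close>

definition extension_of ::
    "('a, 'c) ring_scheme \<Rightarrow> ('a, 'm, 'd) module_scheme \<Rightarrow> ('g, 'b) monoid_scheme \<Rightarrow>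
      ('g \<Rightarrow> 'm \<Rightarrow> 'm) \<Rightarrow> ('g \<Rightarrow> 'a) \<Rightarrow> ('g \<Rightarrow> 'a) \<Rightarrow> bool" where
  "extension_of R M G act \<psi>\<^sub>1 \<psi>\<^sub>2 \<longleftrightarrow>
    (\<exists>W. stable_submodule R M G act W \<and> free_of_rank R (M\<lparr>carrier := W\<rparr>) 1 \<and>
      (\<forall>g\<in>carrier G. \<forall>x\<in>W. act g x = \<psi>\<^sub>2 g \<odot>\<^bsub>M\<^esub> x) \<and>
      (\<forall>g\<in>carrier G. \<forall>x\<in>carrier M. W +>\<^bsub>M\<^esub> act g x = W +>\<^bsub>M\<^esub> (\<psi>\<^sub>1 g \<odot>\<^bsub>M\<^esub> x)))"


section \<open>Lattices\<close>

definition vec_module :: "('k::field, 'k ^ 2) module" where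
  "vec_module =
    \<lparr>carrier = UNIV, mult = undefined, one = undefined, zero = 0, add = (+), smult = (*s)\<rparr>"

definition is_lattice :: "('k::field \<Rightarrow> int) \<Rightarrow> ('k ^ 2) set \<Rightarrow> bool" where
  "is_lattice v \<Lambda> \<longleftrightarrow>
    submodule \<Lambda> (int_ring v) vec_module \<and>
    free_of_rank (int_ring v) (vec_module\<lparr>carrier := \<Lambda>\<rparr>) 2 \<and>
    vec.span \<Lambda> = UNIV"

definition stable_set :: "('g, 'b) monoid_scheme \<Rightarrow> ('g \<Rightarrow> 'k::field ^ 2 ^ 2) \<Rightarrow> ('k ^ 2) set \<Rightarrow> bool" where
  "stable_set G \<rho> \<Lambda> \<longleftrightarrow> (\<forall>g\<in>carrier G. (\<lambda>x. \<rho> g *v x) ` \<Lambda> \<subseteq> \<Lambda>)"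

text \<open>\<open>\<Lambda> / p\<^sup>k \<Lambda>\<close> as a module over \<^term>\<open>quot_ring v p k\<close>.\<close>

definition lattice_quot :: "'k::field \<Rightarrow> nat \<Rightarrow> ('k ^ 2) set \<Rightarrow> ('k set, ('k ^ 2) set) module" where
  "lattice_quot p k \<Lambda> = fact_module (vec_module\<lparr>carrier := \<Lambda>\<rparr>) ((\<lambda>x. p ^ k *s x) ` \<Lambda>)"

text \<open>The induced action on \<open>\<Lambda> / p\<^sup>k \<Lambda>\<close>: for a stable lattice, \<open>\<rho> g\<close> is an automorphism
  of \<open>\<Lambda>\<close>, so the image of a coset is again a coset.\<close>

definition coset_act :: "('g \<Rightarrow> 'k::field ^ 2 ^ 2) \<Rightarrow> 'g \<Rightarrow> ('k ^ 2) set \<Rightarrow> ('k ^ 2) set" where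
  "coset_act \<rho> g X = (\<lambda>x. \<rho> g *v x) ` X"


section \<open>The invariants of a pair of characters\<close>

definition congruence_depth ::
    "('k::field \<Rightarrow> int) \<Rightarrow> 'k \<Rightarrow> nat \<Rightarrow> ('g, 'b) monoid_scheme \<Rightarrow>
      ('g \<Rightarrow> 'k set) \<Rightarrow> ('g \<Rightarrow> 'k set) \<Rightarrow> nat" where
  "congruence_depth v p n G \<chi>\<^sub>1 \<chi>\<^sub>2 =
    (GREATEST m. m \<le> n \<and> (\<forall>g\<in>carrier G. reduce v p m (\<chi>\<^sub>1 g) = reduce v p m (\<chi>\<^sub>2 g)))"

definition extension_depth ::
    "('k::field \<Rightarrow> int) \<Rightarrow> 'k \<Rightarrow> nat \<Rightarrow> ('g, 'b) monoid_scheme \<Rightarrow>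
      ('g \<Rightarrow> 'k set) \<Rightarrow> ('g \<Rightarrow> 'k set) \<Rightarrow> nat" where
  "extension_depth v p n G \<chi>\<^sub>1 \<chi>\<^sub>2 =
    (let m = congruence_depth v p n G \<chi>\<^sub>1 \<chi>\<^sub>2
     in if real m < real n / 2 then n - m else nat \<lceil>real n / 2\<rceil>)"

end

theory Submission
  imports Defs
begin

text \<open>Write \<open>a, b, c, d\<close> for the matrix entries of \<open>\<rho> g\<close> in some basis, \<open>D = a - d\<close> and
  \<open>e = \<chi>\<^sub>1 - \<chi>\<^sub>2\<close>. The trace congruence for \<open>g\<close>, \<open>h\<close> and \<open>gh\<close> gives
  \<open>D(g) D(h) + 2 (b(g) c(h) + b(h) c(g)) \<equiv> e(g) e(h)\<close> modulo \<open>\<pi>\<^sup>n\<close> in every basis. By compactness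
  and irreducibility some \<open>x\<close> in \<open>G\<close> minimises the valuation of \<open>c\<close>, and after rescaling the second
  basis vector \<open>c(x) = 1\<close> and \<open>c\<close> is integral.

  If \<open>m \<ge> n / 2\<close>, start from any first basis vector \<open>u\<close> and take as second one the trace-free part
  of \<open>\<rho> x\<close> applied to \<open>u\<close>. Then \<open>D(x) = 0\<close>, and as \<open>e\<close> vanishes modulo \<open>\<pi>\<^sup>s\<close> the relation forces
  \<open>b \<equiv> 0\<close> modulo \<open>\<pi>\<^sup>n\<close> and \<open>D \<equiv> 0\<close> modulo \<open>\<pi>\<^sup>s\<close>. If \<open>m < n / 2\<close>, choose \<open>y\<close> with \<open>e(y)\<close> of valuation \<open>m\<close>;
  then \<open>\<rho> y\<close> is diagonalisable by completeness, and in a basis of eigenvectors the relation forces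
  \<open>D \<equiv> e\<close> modulo \<open>\<pi>\<^sup>n\<^sup>-\<^sup>m\<close> and \<open>b \<equiv> 0\<close> modulo \<open>\<pi>\<^sup>n\<close>. In both cases the lattice spanned by the basis is
  the required one; it is residually non-split because \<open>c(x) = 1\<close>
  while modulo \<open>\<pi>\<close> either \<open>D\<close> vanishes, or \<open>m = 0\<close>, \<open>c(y) = 0\<close> and \<open>D(y)\<close> is a unit.\<close>

section \<open>Fractional ideals of a discrete valuation\<close>

context discrete_valuation
begin

text \<open>The fractional ideal \<pi>^k O_K, described without choosing \<pi>. The index is an
  integer because a change of basis introduces denominators, and zero is a separate disjunct because
  \<open>v 0\<close> is unspecified.\<close>

definition frac_ideal :: "int \<Rightarrow> 'k set" where
  "frac_ideal k = {x. x = 0 \<or> k \<le> v x}"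

lemma v_one [simp]: "v 1 = 0"
  using v_mult[of 1 1] by simp

lemma v_minus_one: "v (- 1) = 0"
  using v_mult[of "-1" "-1"] by simp

lemma v_minus [simp]: "v (- x) = v x"
  using v_mult[of "-1" x] v_minus_one by (cases "x = 0") auto

lemma v_inverse: "x \<noteq> 0 \<Longrightarrow> v (inverse x) = - v x"
  using v_mult[of x "inverse x"] by simp

lemma v_divide: "x \<noteq> 0 \<Longrightarrow> y \<noteq> 0 \<Longrightarrow> v (x / y) = v x - v y"
  using v_mult[of x "inverse y"] v_inverse[of y] by (simp add: field_simps)

lemma v_power: "x \<noteq> 0 \<Longrightarrow> v (x ^ k) = int k * v x"
  by (induction k) (simp_all add: v_mult algebra_simps)

lemma frac_ideal_zero [simp]: "0 \<in> frac_ideal k"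
  by (simp add: frac_ideal_def)

lemma frac_ideal_one [simp]: "1 \<in> frac_ideal 0"
  by (simp add: frac_ideal_def)

lemma frac_ideal_v: "x \<in> frac_ideal (v x)"
  by (simp add: frac_ideal_def)

lemma frac_ideal_mono: "x \<in> frac_ideal k \<Longrightarrow> j \<le> k \<Longrightarrow> x \<in> frac_ideal j"
  by (auto simp: frac_ideal_def)

lemma frac_ideal_add: "x \<in> frac_ideal k \<Longrightarrow> y \<in> frac_ideal k \<Longrightarrow> x + y \<in> frac_ideal k"
  using v_add[of x y] by (cases "x = 0"; cases "y = 0"; cases "x + y = 0") (auto simp: frac_ideal_def)

lemma frac_ideal_uminus [simp]: "- x \<in> frac_ideal k \<longleftrightarrow> x \<in> frac_ideal k"
  by (simp add: frac_ideal_def)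

lemma frac_ideal_diff: "x \<in> frac_ideal k \<Longrightarrow> y \<in> frac_ideal k \<Longrightarrow> x - y \<in> frac_ideal k"
  using frac_ideal_add[of x k "- y"] by simp

lemma frac_ideal_mult: "x \<in> frac_ideal j \<Longrightarrow> y \<in> frac_ideal k \<Longrightarrow> x * y \<in> frac_ideal (j + k)"
  using v_mult[of x y] by (cases "x = 0"; cases "y = 0") (auto simp: frac_ideal_def)

lemma frac_ideal_int_mult: "x \<in> frac_ideal 0 \<Longrightarrow> y \<in> frac_ideal k \<Longrightarrow> x * y \<in> frac_ideal k"
  using frac_ideal_mult[of x 0 y k] by simp

lemma frac_ideal_mult_int: "x \<in> frac_ideal k \<Longrightarrow> y \<in> frac_ideal 0 \<Longrightarrow> x * y \<in> frac_ideal k"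
  using frac_ideal_mult[of x k y 0] by simp

lemma frac_ideal_cancel: "y \<noteq> 0 \<Longrightarrow> y * x \<in> frac_ideal k \<Longrightarrow> x \<in> frac_ideal (k - v y)"
  using v_mult[of y x] by (cases "x = 0") (auto simp: frac_ideal_def)

text \<open>Since \<open>2 * v x\<close> is even, a lower bound on it may be rounded up to the next
  even number before halving. This rounding is the source of the ceiling of n/2.\<close>

lemma frac_ideal_square: "x * x \<in> frac_ideal k \<Longrightarrow> 2 * j \<le> k + 1 \<Longrightarrow> x \<in> frac_ideal j"
  using v_mult[of x x] by (cases "x = 0") (auto simp: frac_ideal_def)

lemma frac_ideal_add_iff: "x \<in> frac_ideal k \<Longrightarrow> x + y \<in> frac_ideal k \<longleftrightarrow> y \<in> frac_ideal k"
  using frac_ideal_add[of x k y] frac_ideal_diff[of "x + y" k x] by auto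

lemma frac_ideal_diffD: "x - y \<in> frac_ideal k \<Longrightarrow> y \<in> frac_ideal k \<Longrightarrow> x \<in> frac_ideal k"
  using frac_ideal_add[of "x - y" k y] by simp

lemma one_notin_frac_ideal: "1 \<notin> frac_ideal 1"
  by (simp add: frac_ideal_def)

lemma unit_iff: "x \<in> frac_ideal 0 \<and> x \<notin> frac_ideal 1 \<longleftrightarrow> x \<noteq> 0 \<and> v x = 0"
  by (auto simp: frac_ideal_def)

section \<open>Functions with values bounded in the valuation, and compactness\<close>

definition bounded_on :: "'b set \<Rightarrow> ('b \<Rightarrow> 'k) \<Rightarrow> bool" where
  "bounded_on S f \<longleftrightarrow> (\<exists>k. \<forall>x\<in>S. f x \<in> frac_ideal k)"

lemma bounded_on_add:
  assumes "bounded_on S f" "bounded_on S g"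
  shows "bounded_on S (\<lambda>x. f x + g x)"
proof -
  obtain j k where "\<forall>x\<in>S. f x \<in> frac_ideal j" "\<forall>x\<in>S. g x \<in> frac_ideal k"
    using assms unfolding bounded_on_def by blast
  then have "\<forall>x\<in>S. f x + g x \<in> frac_ideal (min j k)"
    by (meson frac_ideal_add frac_ideal_mono min.cobounded1 min.cobounded2)
  then show ?thesis
    unfolding bounded_on_def by blast
qed

lemma bounded_on_mult:
  assumes "bounded_on S f" "bounded_on S g"
  shows "bounded_on S (\<lambda>x. f x * g x)"
  using assms frac_ideal_mult unfolding bounded_on_def by blast

lemma bounded_on_const: "bounded_on S (\<lambda>_. c)"
  unfolding bounded_on_def using frac_ideal_v by blast

text \<open>A nonempty set of integers bounded below has a least element. Stating minimality through
  quotients fits its later use, where a matrix entry is divided by its minimal value.\<close>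

lemma bounded_on_minimum:
  assumes "bounded_on S f" and "x \<in> S" "f x \<noteq> 0"
  obtains y where "y \<in> S" "f y \<noteq> 0" "\<And>z. z \<in> S \<Longrightarrow> f z / f y \<in> frac_ideal 0"
proof -
  obtain k where k: "f z \<in> frac_ideal k" if "z \<in> S" for z
    using assms(1) unfolding bounded_on_def by blast
  define P where "P z \<longleftrightarrow> z \<in> S \<and> f z \<noteq> 0" for z
  have "P x"
    using assms by (simp add: P_def)
  \<comment> \<open>On \<open>P\<close> the difference of valuation and \<open>k\<close> is
    nonnegative, so \<open>nat\<close> loses no information and the well-ordering of the naturals
    applies.\<close>
  then obtain y where y: "P y" and min: "\<And>z. P z \<Longrightarrow> nat (v (f y) - k) \<le> nat (v (f z) - k)"
    using ex_has_least_nat[of P x "\<lambda>z. nat (v (f z) - k)"] by blast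
  have "f z / f y \<in> frac_ideal 0" if "z \<in> S" for z
  proof (cases "f z = 0")
    case False
    then have "v (f y) \<le> v (f z)"
      using min[of z] k[of z] k[of y] y that by (auto simp: P_def frac_ideal_def)
    then show ?thesis
      using v_divide[of "f z" "f y"] False y by (simp add: P_def frac_ideal_def)
  qed simp
  with y that show ?thesis
    by (auto simp: P_def)
qed

subsection \<open>The valuation metric\<close>

lemma vdist_le_iff: "vdist v x y \<le> 2 powr - real_of_int k \<longleftrightarrow> x - y \<in> frac_ideal k"
  by (auto simp: vdist_def frac_ideal_def)

lemma Metric_space_vdist: "Metric_space UNIV (vdist v)"
proof
  show "vdist v x y = vdist v y x" for x y
    using v_minus[of "x - y"] by (simp add: vdist_def)
  show "vdist v x z \<le> vdist v x y + vdist v y z" for x y z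
  proof (cases "x = y \<or> y = z \<or> x = z")
    case False
    let ?k = "min (v (x - y)) (v (y - z))"
    have "x - z \<in> frac_ideal ?k"
      using frac_ideal_add[of "x - y" ?k "y - z"] False by (simp add: frac_ideal_def)
    then have "vdist v x z \<le> 2 powr - real_of_int ?k"
      by (simp add: vdist_le_iff)
    also have "\<dots> \<le> vdist v x y + vdist v y z"
      using False by (simp add: vdist_def min_def)
    finally show ?thesis .
  qed (auto simp: vdist_def)
qed (auto simp: vdist_def)

text \<open>A continuous image of a compact space is compact, hence metrically bounded, and metric
  boundedness is a lower bound on valuations.\<close>

lemma bounded_on_compact_space:
  assumes "continuous_map T (valuation_topology v) f" and "compact_space T"
  shows "bounded_on (topspace T) f"
proof -
  interpret M: Metric_space UNIV "vdist v"
    by (rule Metric_space_vdist)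
  have "compactin M.mtopology (f ` topspace T)"
    using assms image_compactin unfolding compact_space_def valuation_topology_def by blast
  then have "M.mbounded (f ` topspace T)"
    by (rule M.compactin_imp_mbounded)
  then obtain y B where B: "0 < B" "\<And>x. x \<in> topspace T \<Longrightarrow> vdist v y (f x) \<le> B"
    unfolding M.mbounded_pos M.mcball_def by blast
  \<comment> \<open>Rounds the radius up to a power of 2, so that the ball becomes a coset of
    \<open>frac_ideal k\<close>.\<close>
  define k where "k = - \<lceil>log 2 B\<rceil>"
  have "B \<le> 2 powr - real_of_int k"
    unfolding k_def using \<open>0 < B\<close> by (simp add: le_powr_iff)
  then have "y - f x \<in> frac_ideal k" if "x \<in> topspace T" for x
    using B(2)[OF that] vdist_le_iff[of y "f x" k] by linarith
  then have "bounded_on (topspace T) (\<lambda>x. y - f x)"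
    unfolding bounded_on_def by blast
  then have "bounded_on (topspace T) (\<lambda>x. y + (- 1) * (y - f x))"
    by (intro bounded_on_add bounded_on_mult bounded_on_const)
  then show ?thesis
    by simp
qed

end

section \<open>Square roots of elements congruent to 1\<close>

context complete_discrete_valuation
begin

text \<open>The Newton map \<open>x \<mapsto> x - (x\<^sup>2 - u) / 2\<close> contracts \<open>1 + \<pp>\<close>; extending it
  by the constant \<open>1\<close> keeps it a contraction because points outside have distance at least \<open>1\<close>
  from \<open>1 + \<pp>\<close>.\<close>

lemma square_root:
  assumes two: "2 \<notin> frac_ideal 1" and u: "u - 1 \<in> frac_ideal 1"
  obtains w where "w - 1 \<in> frac_ideal 1" "w * w = u"
proof -
  interpret M: Metric_space UNIV "vdist v"
    by (rule Metric_space_vdist)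
  have "(2 :: 'a) \<in> frac_ideal 0"
    using frac_ideal_add[of 1 0 1] by simp
  then have two0: "(2 :: 'a) \<noteq> 0" and vtwo: "v 2 = 0"
    using two unit_iff by blast+
  have four0: "(4 :: 'a) \<noteq> 0"
    using two0 mult_eq_0_iff[of "2 :: 'a" 2] by simp
  have half: "x / 2 \<in> frac_ideal k" if "x \<in> frac_ideal k" for x k
    using frac_ideal_cancel[of 2 "x / 2" k] that two0 vtwo by simp
  define f where "f x = (if x - 1 \<in> frac_ideal 1 then x - (x * x - u) / 2 else 1)" for x
  have f1: "f x - 1 \<in> frac_ideal 1" for x
  proof (cases "x - 1 \<in> frac_ideal 1")
    case True
    have "f x - 1 = (u - 1) / 2 - (x - 1) * (x - 1) / 2"
      using True two0 four0 by (simp add: f_def field_simps)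
    moreover have "(x - 1) * (x - 1) \<in> frac_ideal 1"
      using frac_ideal_mult[OF True True] by (rule frac_ideal_mono) simp
    ultimately show ?thesis
      using u by (simp add: half frac_ideal_diff)
  qed (simp add: f_def)
  have con: "vdist v (f x) (f y) \<le> 1 / 2 * vdist v x y" for x y
  proof (cases "x = y")
    case False
    have "f x - f y \<in> frac_ideal (v (x - y) + 1)"
    proof (cases "x - 1 \<in> frac_ideal 1 \<and> y - 1 \<in> frac_ideal 1")
      case True
      \<comment> \<open>The second factor is 1 - (x + y)/2, written so that it visibly lies in the
        maximal ideal. It raises the valuation by at least one, which gives the contraction constant
        1/2.\<close>
      have "f x - f y = (x - y) * (- ((x - 1) / 2) - (y - 1) / 2)"
        using True two0 four0 by (simp add: f_def field_simps)
      then show ?thesis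
        using frac_ideal_mult[OF frac_ideal_v[of "x - y"], of "- ((x - 1) / 2) - (y - 1) / 2" 1] True
        by (simp add: frac_ideal_diff half)
    next
      case out: False
      show ?thesis
      proof (cases "x - 1 \<notin> frac_ideal 1 \<and> y - 1 \<notin> frac_ideal 1")
        case True
        then show ?thesis
          by (simp add: f_def)
      next
        case False
        have "x - y \<notin> frac_ideal 1"
          using out False frac_ideal_add_iff[of "x - y" 1 "y - 1"] by auto
        then have "v (x - y) + 1 \<le> 1"
          by (simp add: frac_ideal_def)
        moreover have "f x - f y \<in> frac_ideal 1"
          using frac_ideal_diff[OF f1[of x] f1[of y]] by simp
        ultimately show ?thesis
          by (rule frac_ideal_mono[rotated])
      qed
    qed
    then have "vdist v (f x) (f y) \<le> 2 powr - real_of_int (v (x - y) + 1)"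
      by (simp add: vdist_le_iff del: of_int_add)
    also have "\<dots> = 1 / 2 * vdist v x y"
      using False by (simp add: vdist_def powr_diff powr_minus field_simps)
    finally show ?thesis .
  qed (simp add: vdist_def)
  obtain w where w: "f w = w"
    using M.Banach_fixedpoint_thm[OF complete, of f "1 / 2"] con by auto
  \<comment> \<open>All values of \<open>f\<close> are congruent to 1, hence so is its fixed point,
    and there \<open>f\<close> is the Newton map.\<close>
  then have w1: "w - 1 \<in> frac_ideal 1"
    using f1[of w] by simp
  then have "w - (w * w - u) / 2 = w"
    using w by (simp add: f_def)
  then have "w * w = u"
    using two0 by simp
  with w1 that show ?thesis
    by blast
qed

end

section \<open>Two-by-two matrices\<close>

lemma inverse_matrix_2:
  fixes P :: "'k::field ^ 2 ^ 2"
  assumes "P $ 1 $ 1 * P $ 2 $ 2 - P $ 1 $ 2 * P $ 2 $ 1 \<noteq> 0"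
  obtains Q where "Q ** P = mat 1" "P ** Q = mat 1"
proof -
  have "invertible P"
    using assms invertible_det_nz[of P] by (simp add: det_2)
  with that show ?thesis
    unfolding invertible_def by blast
qed

abbreviation matrix_2 :: "'k::field \<Rightarrow> 'k \<Rightarrow> 'k \<Rightarrow> 'k \<Rightarrow> 'k ^ 2 ^ 2" where
  "matrix_2 a b c d \<equiv> vector [vector [a, b], vector [c, d]]"

lemma matrix_mult_2: "(A ** B) $ i $ j = A $ i $ 1 * B $ 1 $ j + A $ i $ 2 * B $ 2 $ j"
  for A B :: "'k::field ^ 2 ^ 2"
  by (simp add: matrix_matrix_mult_def sum_2)

lemma matrix_vector_mult_2: "(A *v x) $ i = A $ i $ 1 * x $ 1 + A $ i $ 2 * x $ 2"
  for A :: "'k::field ^ 2 ^ 2"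
  by (simp add: matrix_vector_mult_def sum_2)

lemma trace_2: "trace A = A $ 1 $ 1 + A $ 2 $ 2"
  for A :: "'k::field ^ 2 ^ 2"
  by (simp add: trace_def sum_2)

lemma matrix_eq_2: "A = B \<longleftrightarrow> A $ 1 $ 1 = B $ 1 $ 1 \<and> A $ 1 $ 2 = B $ 1 $ 2 \<and>
    A $ 2 $ 1 = B $ 2 $ 1 \<and> A $ 2 $ 2 = B $ 2 $ 2"
  for A B :: "'k::field ^ 2 ^ 2"
  by (auto simp: vec_eq_iff forall_2)

lemma conjugate_mult:
  assumes "P ** Q = mat 1"
  shows "Q ** (A ** B) ** P = (Q ** A ** P) ** (Q ** B ** P)"
proof -
  have "(Q ** A ** P) ** (Q ** B ** P) = Q ** A ** (P ** Q) ** (B ** P)"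
    by (simp only: matrix_mul_assoc)
  then show ?thesis
    by (simp add: assms matrix_mul_assoc)
qed

lemma trace_conjugate:
  assumes "P ** Q = mat 1"
  shows "trace (Q ** A ** P) = trace (A :: 'k::field ^ 2 ^ 2)"
  using trace_mul_sym[of "Q ** A" P] assms by (simp add: matrix_mul_assoc)

text \<open>By hypothesis the discriminant of the characteristic polynomial is the square of
  \<open>w\<close>, so the eigenvalues lie in the field and are distinct. The order
  \<open>l1 - l2 = w\<close> is kept, as it decides which eigenvalue belongs to which
  character.\<close>

lemma diagonalise_2:
  fixes A :: "'k::field ^ 2 ^ 2"
  assumes disc: "(A $ 1 $ 1 - A $ 2 $ 2) * (A $ 1 $ 1 - A $ 2 $ 2) + 4 * (A $ 1 $ 2 * A $ 2 $ 1) = w * w"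
    and "w \<noteq> 0" and two: "(2 :: 'k) \<noteq> 0"
  obtains P Q l1 l2 where "Q ** P = mat 1" "P ** Q = mat 1" "Q ** A ** P = matrix_2 l1 0 0 l2"
    "l1 - l2 = w"
proof -
  define a b c d where "a = A $ 1 $ 1" and "b = A $ 1 $ 2" and "c = A $ 2 $ 1" and "d = A $ 2 $ 2"
  note entries = a_def[symmetric] b_def[symmetric] c_def[symmetric] d_def[symmetric]
  have disc': "w * w = (a - d) * (a - d) + 4 * (b * c)"
    using disc by (simp add: entries)
  have four: "(4 :: 'k) \<noteq> 0"
    using two mult_eq_0_iff[of "2 :: 'k" 2] by simp
  define l1 l2 where "l1 = (a + d + w) / 2" and "l2 = (a + d - w) / 2"
  have l: "2 * l1 = a + d + w" "2 * l2 = a + d - w"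
    using two by (simp_all add: l1_def l2_def)
  have "2 * (l1 - l2) = 2 * w" "2 * (a + d) = 2 * (l1 + l2)"
    unfolding right_diff_distrib distrib_left l by simp_all
  then have l12: "l1 - l2 = w" and tr: "a + d = l1 + l2"
    using two mult_left_cancel by blast+
  have "4 * (l1 * l2) = (2 * l1) * (2 * l2)"
    by simp
  also have "\<dots> = (a + d) * (a + d) - w * w"
    unfolding l by (simp add: algebra_simps)
  also have "\<dots> = 4 * (a * d - b * c)"
    unfolding disc' by (simp add: algebra_simps)
  finally have "l1 * l2 = a * d - b * c"
    by (rule iffD1[OF mult_left_cancel[OF four]])
  then have dt: "b * c = a * d - l1 * l2"
    by simp
  have d: "d = l1 + l2 - a"
    using tr by (simp add: eq_diff_eq add.commute)
  have "\<exists>P l1 l2. P $ 1 $ 1 * P $ 2 $ 2 - P $ 1 $ 2 * P $ 2 $ 1 \<noteq> 0 \<and>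
      A ** P = P ** matrix_2 l1 0 0 l2 \<and> l1 - l2 = w"
  proof (cases "b = 0")
    case False
    \<comment> \<open>This is the determinant of the matrix with columns \<open>(b, l1 - a)\<close>
      and \<open>(b, l2 - a)\<close>, the eigenvectors read off from the first row.\<close>
    have "b * (l2 - a) - b * (l1 - a) = - (b * (l1 - l2))"
      by (simp add: algebra_simps)
    also have "\<dots> \<noteq> 0"
      using False \<open>w \<noteq> 0\<close> l12 by simp
    finally have "b * (l2 - a) - b * (l1 - a) \<noteq> 0" .
    moreover have "c * b + d * (l1 - a) = (l1 - a) * l1" "c * b + d * (l2 - a) = (l2 - a) * l2"
      unfolding mult.commute[of c b] dt d by (simp_all add: algebra_simps)
    ultimately show ?thesis
      using l12 by (intro exI[of _ "matrix_2 b b (l1 - a) (l2 - a)"] exI[of _ l1] exI[of _ l2])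
        (simp add: matrix_eq_2 matrix_mult_2 vector_2 entries algebra_simps)
  next
    case b0: True
    show ?thesis
    proof (cases "c = 0")
      case False
      \<comment> \<open>The same with the columns \<open>(l1 - d, c)\<close> and
        \<open>(l2 - d, c)\<close>, read off from the second row.\<close>
      have "(l1 - d) * c - (l2 - d) * c = c * (l1 - l2)"
        by (simp add: algebra_simps)
      also have "\<dots> \<noteq> 0"
        using False \<open>w \<noteq> 0\<close> l12 by simp
      finally have "(l1 - d) * c - (l2 - d) * c \<noteq> 0" .
      moreover have "a * (l1 - d) + b * c = (l1 - d) * l1" "a * (l2 - d) + b * c = (l2 - d) * l2"
        unfolding dt d by (simp_all add: algebra_simps)
      ultimately show ?thesis
        using l12 by (intro exI[of _ "matrix_2 (l1 - d) (l2 - d) c c"] exI[of _ l1] exI[of _ l2])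
          (simp add: matrix_eq_2 matrix_mult_2 vector_2 entries b0 algebra_simps)
    next
      case True
      \<comment> \<open>The matrix is already diagonal; at most a permutation of the basis is needed
        to put \<open>l1\<close> first.\<close>
      have "(l1 - a) * (l2 - a) = 0"
        using dt unfolding d by (simp add: b0 algebra_simps)
      then have "l1 = a \<and> l2 = d \<or> l1 = d \<and> l2 = a"
        by (auto simp: d)
      then show ?thesis
      proof
        assume "l1 = a \<and> l2 = d"
        then show ?thesis
          using l12 True b0 by (intro exI[of _ "matrix_2 1 0 0 1"] exI[of _ l1] exI[of _ l2])
            (simp add: matrix_eq_2 matrix_mult_2 vector_2 entries)
      next
        assume "l1 = d \<and> l2 = a"
        then show ?thesis
          using l12 True b0 by (intro exI[of _ "matrix_2 0 1 1 0"] exI[of _ l1] exI[of _ l2])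
            (simp add: matrix_eq_2 matrix_mult_2 vector_2 entries)
      qed
    qed
  qed
  then obtain P l1 l2 where P: "P $ 1 $ 1 * P $ 2 $ 2 - P $ 1 $ 2 * P $ 2 $ 1 \<noteq> 0"
      and AP: "A ** P = P ** matrix_2 l1 0 0 l2" and l: "l1 - l2 = w"
    by blast
  obtain Q where Q: "Q ** P = mat 1" "P ** Q = mat 1"
    using inverse_matrix_2[OF P] .
  have "Q ** A ** P = Q ** (P ** matrix_2 l1 0 0 l2)"
    by (simp add: matrix_mul_assoc[symmetric] AP)
  also have "\<dots> = matrix_2 l1 0 0 l2"
    by (simp only: matrix_mul_assoc Q matrix_mul_lid)
  finally show ?thesis
    using that Q l by blast
qed

section \<open>Bases adapted to a reducible trace\<close>

text \<open>The pair \<open>P, Q\<close> stands for a change of basis and its inverse. Irreducibility and boundedness enter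
  only through \<open>minimal_entry\<close>; the trace congruence only through \<open>gram\<close>, which says that
  twice the trace form on the trace-free parts has rank one modulo the \<open>n\<close>-th power of the
  maximal ideal.\<close>

locale reducible_trace = complete_discrete_valuation v
  for v :: "'k::field \<Rightarrow> int" +
  fixes S :: "'g set" and \<rho> :: "'g \<Rightarrow> 'k ^ 2 ^ 2" and e :: "'g \<Rightarrow> 'k" and n :: nat
  assumes two: "2 \<notin> frac_ideal 1"
    and minimal_entry: "\<And>P Q :: 'k ^ 2 ^ 2. Q ** P = mat 1 \<Longrightarrow> P ** Q = mat 1 \<Longrightarrow>
      \<exists>x\<in>S. (Q ** \<rho> x ** P) $ 2 $ 1 \<noteq> 0 \<and>
        (\<forall>g\<in>S. (Q ** \<rho> g ** P) $ 2 $ 1 / (Q ** \<rho> x ** P) $ 2 $ 1 \<in> frac_ideal 0)"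
    and e_int: "g \<in> S \<Longrightarrow> e g \<in> frac_ideal 0"
    and gram: "g \<in> S \<Longrightarrow> h \<in> S \<Longrightarrow>
      2 * trace (\<rho> g ** \<rho> h) - trace (\<rho> g) * trace (\<rho> h) - e g * e h \<in> frac_ideal n"
begin

lemma two_nonzero: "(2 :: 'k) \<noteq> 0" and v_two: "v 2 = 0"
  using two unit_iff[of 2] frac_ideal_add[of 1 0 1] by auto

lemma twice_iff: "2 * x \<in> frac_ideal k \<longleftrightarrow> x \<in> frac_ideal k"
  using frac_ideal_cancel[of 2 x k] frac_ideal_add[of x k x] two_nonzero v_two by auto

text \<open>The \<open>D\<close> of the overview. The discriminant of the characteristic polynomial
  is its square plus four times the product of the off-diagonal entries.\<close>

definition disc :: "'k ^ 2 ^ 2 \<Rightarrow> 'k" where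
  "disc A = A $ 1 $ 1 - A $ 2 $ 2"

text \<open>The form \<open>2 * trace (A ** B) - trace A * trace B\<close> is invariant under
  conjugation, so \<open>gram\<close> may be expanded in the entries with respect to any
  basis.\<close>

lemma gram_entries:
  fixes P Q :: "'k ^ 2 ^ 2"
  assumes "Q ** P = mat 1" "P ** Q = mat 1" "g \<in> S" "h \<in> S"
    and "R = (\<lambda>g. Q ** \<rho> g ** P)"
  shows "disc (R g) * disc (R h) +
    2 * (R g $ 1 $ 2 * R h $ 2 $ 1 + R h $ 1 $ 2 * R g $ 2 $ 1) - e g * e h \<in> frac_ideal n"
proof -
  have "2 * trace (\<rho> g ** \<rho> h) - trace (\<rho> g) * trace (\<rho> h) =
      2 * trace (R g ** R h) - trace (R g) * trace (R h)"
    using assms(2) by (simp add: \<open>R = _\<close> conjugate_mult[symmetric] trace_conjugate)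
  also have "\<dots> = disc (R g) * disc (R h) +
      2 * (R g $ 1 $ 2 * R h $ 2 $ 1 + R h $ 1 $ 2 * R g $ 2 $ 1)"
    by (simp add: disc_def trace_2 matrix_mult_2 algebra_simps)
  finally show ?thesis
    using gram[OF assms(3,4)] by simp
qed

text \<open>The second basis vector is scaled by a lower left entry of minimal valuation. The effect
  on an arbitrary matrix is recorded so that a matrix diagonal before the scaling is seen to stay
  diagonal.\<close>

lemma normalised_basis:
  fixes P Q :: "'k ^ 2 ^ 2"
  assumes "Q ** P = mat 1" "P ** Q = mat 1"
  obtains P' Q' :: "'k ^ 2 ^ 2" and c x where "Q' ** P' = mat 1" "P' ** Q' = mat 1" "c \<noteq> 0" "x \<in> S"
    "\<And>A. Q' ** A ** P' = matrix_2 ((Q ** A ** P) $ 1 $ 1) (c * (Q ** A ** P) $ 1 $ 2)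
      ((Q ** A ** P) $ 2 $ 1 / c) ((Q ** A ** P) $ 2 $ 2)"
    "(Q' ** \<rho> x ** P') $ 2 $ 1 = 1"
    "\<And>g. g \<in> S \<Longrightarrow> (Q' ** \<rho> g ** P') $ 2 $ 1 \<in> frac_ideal 0"
proof -
  obtain x where x: "x \<in> S" and c0: "(Q ** \<rho> x ** P) $ 2 $ 1 \<noteq> 0"
    and min: "\<And>g. g \<in> S \<Longrightarrow> (Q ** \<rho> g ** P) $ 2 $ 1 / (Q ** \<rho> x ** P) $ 2 $ 1 \<in> frac_ideal 0"
    using minimal_entry[OF assms] by blast
  define c where "c = (Q ** \<rho> x ** P) $ 2 $ 1"
  define E F where "E = matrix_2 1 0 0 c" and "F = matrix_2 1 0 0 (1 / c)"
  have EF: "E ** F = mat 1" "F ** E = mat 1"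
    using c0 by (simp_all add: E_def F_def c_def matrix_eq_2 matrix_mult_2 vector_2 mat_def)
  have scale: "F ** M ** E = matrix_2 (M $ 1 $ 1) (c * M $ 1 $ 2) (M $ 2 $ 1 / c) (M $ 2 $ 2)" for M
    using c0 by (simp add: E_def F_def c_def matrix_eq_2 matrix_mult_2 vector_2)
  have entries: "(F ** Q) ** A ** (P ** E) =
      matrix_2 ((Q ** A ** P) $ 1 $ 1) (c * (Q ** A ** P) $ 1 $ 2)
      ((Q ** A ** P) $ 2 $ 1 / c) ((Q ** A ** P) $ 2 $ 2)" for A
    unfolding scale[symmetric] by (simp only: matrix_mul_assoc)
  have "(F ** Q) ** (P ** E) = F ** (Q ** P) ** E" "(P ** E) ** (F ** Q) = P ** (E ** F) ** Q"
    by (simp_all only: matrix_mul_assoc)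
  then have "(F ** Q) ** (P ** E) = mat 1" "(P ** E) ** (F ** Q) = mat 1"
    by (simp_all add: assms EF)
  then show ?thesis
    using that[of "F ** Q" "P ** E" c x] x min c0 unfolding entries by (simp add: vector_2 c_def)
qed

text \<open>The case m \<ge> n/2. The bounds on \<open>s\<close> say that it is n/2 rounded up;
  \<open>n \<le> 2 * s\<close> makes every product \<open>e g * e h\<close> vanish modulo
  \<pi>^n.\<close>

lemma adapted_basis_close:
  fixes s :: int
  assumes e: "\<And>g. g \<in> S \<Longrightarrow> e g \<in> frac_ideal s" and s: "1 \<le> s" "n \<le> 2 * s" "2 * s \<le> n + 1"
  obtains P Q :: "'k ^ 2 ^ 2" and x where "Q ** P = mat 1" "P ** Q = mat 1" "x \<in> S" "(Q ** \<rho> x ** P) $ 2 $ 1 = 1"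
    "\<And>g. g \<in> S \<Longrightarrow> (Q ** \<rho> g ** P) $ 2 $ 1 \<in> frac_ideal 0"
    "\<And>g. g \<in> S \<Longrightarrow> (Q ** \<rho> g ** P) $ 1 $ 2 \<in> frac_ideal s"
    "\<And>g. g \<in> S \<Longrightarrow> disc (Q ** \<rho> g ** P) - e g \<in> frac_ideal s"
proof -
  obtain P Q :: "'k ^ 2 ^ 2" and x where PQ: "Q ** P = mat 1" "P ** Q = mat 1" and x: "x \<in> S"
    and cx: "(Q ** \<rho> x ** P) $ 2 $ 1 = 1"
    and c: "\<And>g. g \<in> S \<Longrightarrow> (Q ** \<rho> g ** P) $ 2 $ 1 \<in> frac_ideal 0"
    by (rule normalised_basis[of "mat 1" "mat 1"]) auto
  \<comment> \<open>Adding \<open>t\<close> times the first basis vector to the second subtracts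
    \<open>2 * t * c(g)\<close> from D(g) and fixes c(g). As c(x) = 1, this \<open>t\<close>
    achieves D(x) = 0.\<close>
  define t where "t = disc (Q ** \<rho> x ** P) / 2"
  define E F where "E = matrix_2 1 t 0 1" and "F = matrix_2 1 (- t) 0 1"
  have EF: "E ** F = mat 1" "F ** E = mat 1"
    by (simp_all add: E_def F_def matrix_eq_2 matrix_mult_2 vector_2 mat_def)
  define R where "R = (\<lambda>g. (F ** Q) ** \<rho> g ** (P ** E))"
  have R: "R g = F ** (Q ** \<rho> g ** P) ** E" for g
    unfolding R_def by (simp only: matrix_mul_assoc)
  have shear: "(F ** M ** E) $ 2 $ 1 = M $ 2 $ 1" "disc (F ** M ** E) = disc M - 2 * t * M $ 2 $ 1" for M
    by (simp_all add: E_def F_def disc_def matrix_mult_2 vector_2 algebra_simps)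
  have R21: "R g $ 2 $ 1 = (Q ** \<rho> g ** P) $ 2 $ 1" for g
    unfolding R shear ..
  have "disc (R x) = disc (Q ** \<rho> x ** P) - 2 * t * (Q ** \<rho> x ** P) $ 2 $ 1"
    unfolding R shear ..
  then have Dx: "disc (R x) = 0"
    using two_nonzero by (simp add: cx t_def)
  have "(F ** Q) ** (P ** E) = F ** (Q ** P) ** E" "(P ** E) ** (F ** Q) = P ** (E ** F) ** Q"
    by (simp_all only: matrix_mul_assoc)
  then have PQ': "(F ** Q) ** (P ** E) = mat 1" "(P ** E) ** (F ** Q) = mat 1"
    by (simp_all add: PQ EF)
  note G = gram_entries[OF PQ' _ _ R_def]
  have ee: "e g * e h \<in> frac_ideal n" if "g \<in> S" "h \<in> S" for g h
    using frac_ideal_mult[OF e[OF that(1)] e[OF that(2)]] by (rule frac_ideal_mono) (use s in simp)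
  \<comment> \<open>The relation for x with itself, where D(x) = 0 and c(x) = 1. Pairing g with x
    then bounds b(g).\<close>
  have "2 * (R x $ 1 $ 2 + R x $ 1 $ 2) \<in> frac_ideal n"
    using frac_ideal_diffD[OF G[OF x x] ee[OF x x]] by (simp add: Dx R21 cx)
  then have bx: "R x $ 1 $ 2 \<in> frac_ideal n"
    by (simp only: twice_iff mult_2[symmetric])
  have b: "R g $ 1 $ 2 \<in> frac_ideal n" if g: "g \<in> S" for g
  proof -
    have "2 * (R g $ 1 $ 2 + R x $ 1 $ 2 * R g $ 2 $ 1) \<in> frac_ideal n"
      using frac_ideal_diffD[OF G[OF g x] ee[OF g x]] by (simp add: Dx R21 cx)
    then have "R g $ 1 $ 2 + R x $ 1 $ 2 * R g $ 2 $ 1 \<in> frac_ideal n"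
      by (simp only: twice_iff)
    then show ?thesis
      using frac_ideal_diff[OF _ frac_ideal_mult_int[OF bx c[OF g]]] by (fastforce simp: R21)
  qed
  have D: "disc (R g) \<in> frac_ideal s" if g: "g \<in> S" for g
  proof -
    have "R g $ 1 $ 2 * R g $ 2 $ 1 \<in> frac_ideal n"
      using frac_ideal_mult_int[OF b[OF g] c[OF g]] by (simp add: R21)
    then have "2 * (R g $ 1 $ 2 * R g $ 2 $ 1 + R g $ 1 $ 2 * R g $ 2 $ 1) - e g * e g \<in> frac_ideal n"
      by (intro frac_ideal_diff ee[OF g g]) (simp only: twice_iff mult_2[symmetric])
    \<comment> \<open>In the relation for g with itself only the square of D(g) is left;
      \<open>2 * s \<le> n + 1\<close> allows halving with rounding up.\<close>
    then have "disc (R g) * disc (R g) \<in> frac_ideal n"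
      using frac_ideal_diff[OF G[OF g g]] by (fastforce simp: algebra_simps)
    then show ?thesis
      by (rule frac_ideal_square) (use s in simp)
  qed
  show ?thesis
  proof (rule that[OF PQ' x])
    show "(F ** Q ** \<rho> x ** (P ** E)) $ 2 $ 1 = 1"
      using R21[of x] cx by (simp add: R_def)
    fix g assume g: "g \<in> S"
    show "(F ** Q ** \<rho> g ** (P ** E)) $ 2 $ 1 \<in> frac_ideal 0"
      using R21[of g] c[OF g] by (simp add: R_def)
    show "(F ** Q ** \<rho> g ** (P ** E)) $ 1 $ 2 \<in> frac_ideal s"
      using frac_ideal_mono[OF b[OF g], of s] s by (simp add: R_def)
    show "disc (F ** Q ** \<rho> g ** (P ** E)) - e g \<in> frac_ideal s"
      using frac_ideal_diff[OF D[OF g] e[OF g]] by (simp add: R_def)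
  qed
qed

text \<open>The case m < n/2, where \<open>e y\<close> has valuation exactly m. Diagonalising
  \<open>\<rho> y\<close> turns the relation with y into a linear condition on D, at the price of m
  digits of precision. The last conclusion, c(y) = 0, serves residual non-splitness.\<close>

lemma adapted_basis_far:
  fixes m :: int
  assumes e: "\<And>g. g \<in> S \<Longrightarrow> e g \<in> frac_ideal m" and y: "y \<in> S" "e y \<notin> frac_ideal (m + 1)"
    and m: "2 * m < int n" "0 \<le> m"
  obtains P Q :: "'k ^ 2 ^ 2" and x where "Q ** P = mat 1" "P ** Q = mat 1" "x \<in> S" "(Q ** \<rho> x ** P) $ 2 $ 1 = 1"
    "\<And>g. g \<in> S \<Longrightarrow> (Q ** \<rho> g ** P) $ 2 $ 1 \<in> frac_ideal 0"
    "\<And>g. g \<in> S \<Longrightarrow> (Q ** \<rho> g ** P) $ 1 $ 2 \<in> frac_ideal n"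
    "\<And>g. g \<in> S \<Longrightarrow> disc (Q ** \<rho> g ** P) - e g \<in> frac_ideal (n - m)"
    "(Q ** \<rho> y ** P) $ 2 $ 1 = 0"
proof -
  have ey: "e y \<noteq> 0" "v (e y) = m"
    using e[OF y(1)] y(2) by (auto simp: frac_ideal_def)
  \<comment> \<open>The discriminant of the characteristic polynomial of \<open>\<rho> y\<close>.
    The relation for y with itself makes it congruent to the square of \<open>e y\<close>, so the
    quotient \<open>u\<close> is close to 1 because 2m < n.\<close>
  let ?q = "disc (\<rho> y) * disc (\<rho> y) + 4 * (\<rho> y $ 1 $ 2 * \<rho> y $ 2 $ 1)"
  define u where "u = ?q / (e y * e y)"
  have "?q - e y * e y \<in> frac_ideal n"
    using gram_entries[of "mat 1" "mat 1", OF _ _ y(1) y(1) refl] by (simp add: algebra_simps)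
  moreover have "?q - e y * e y = (e y * e y) * (u - 1)"
    using ey by (simp add: u_def field_simps)
  ultimately have "u - 1 \<in> frac_ideal (n - v (e y * e y))"
    using frac_ideal_cancel[of "e y * e y" "u - 1" n] ey by simp
  then have u: "u - 1 \<in> frac_ideal (n - 2 * m)"
    using v_mult[of "e y" "e y"] ey by simp
  then have "u - 1 \<in> frac_ideal 1"
    by (rule frac_ideal_mono) (use m in simp)
  then obtain z where z: "z - 1 \<in> frac_ideal 1" "z * z = u"
    using square_root two by blast
  \<comment> \<open>As z is congruent to 1 and 2 is a unit, z + 1 is a unit. So z - 1 inherits from
    u - 1 = (z + 1)(z - 1) the full precision n - 2m.\<close>
  have "z + 1 \<in> frac_ideal 0 \<and> z + 1 \<notin> frac_ideal 1"
  proof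
    have "z - 1 + 2 \<in> frac_ideal 0"
      using frac_ideal_add[OF frac_ideal_mono[OF z(1)], of 0 2] v_two by (simp add: frac_ideal_def)
    then show "z + 1 \<in> frac_ideal 0"
      by (simp add: algebra_simps)
    have "z + 1 = (z - 1) + 2"
      by simp
    then show "z + 1 \<notin> frac_ideal 1"
      using frac_ideal_add_iff[OF z(1), of 2] two by metis
  qed
  then have z1: "z + 1 \<noteq> 0" "v (z + 1) = 0"
    using unit_iff by blast+
  have "(z + 1) * (z - 1) \<in> frac_ideal (n - 2 * m)"
    using u z(2) by (simp add: algebra_simps)
  then have z2: "z - 1 \<in> frac_ideal (n - 2 * m)"
    using frac_ideal_cancel[of "z + 1" "z - 1"] z1 by fastforce
  define w where "w = e y * z"
  have "z \<in> frac_ideal 0 \<and> z \<notin> frac_ideal 1"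
    using frac_ideal_add_iff[OF z(1), of 1] one_notin_frac_ideal
      frac_ideal_diffD[OF frac_ideal_mono[OF z(1)], of 0] by simp
  then have z0: "z \<noteq> 0" "v z = 0"
    using unit_iff by blast+
  have w: "w \<noteq> 0" "v w = m"
    using ey z0 v_mult by (auto simp: w_def)
  have we: "w - e y \<in> frac_ideal (n - m)"
    using frac_ideal_mult[OF frac_ideal_v[of "e y"] z2] ey by (simp add: w_def algebra_simps)
  have "?q = u * (e y * e y)"
    using ey by (simp add: u_def)
  also have "\<dots> = w * w"
    by (simp add: w_def flip: z(2))
  finally have qw: "?q = w * w" .
  obtain P0 Q0 l1 l2 where PQ0: "Q0 ** P0 = mat 1" "P0 ** Q0 = mat 1"
    and diag: "Q0 ** \<rho> y ** P0 = matrix_2 l1 0 0 l2" and l: "l1 - l2 = w"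
    by (rule diagonalise_2[OF qw[unfolded disc_def] w(1) two_nonzero])
  obtain P Q c x where PQ: "Q ** P = mat 1" "P ** Q = mat 1" and x: "x \<in> S"
    and conj: "\<And>A. Q ** A ** P = matrix_2 ((Q0 ** A ** P0) $ 1 $ 1) (c * (Q0 ** A ** P0) $ 1 $ 2)
      ((Q0 ** A ** P0) $ 2 $ 1 / c) ((Q0 ** A ** P0) $ 2 $ 2)"
    and cx: "(Q ** \<rho> x ** P) $ 2 $ 1 = 1"
    and c: "\<And>g. g \<in> S \<Longrightarrow> (Q ** \<rho> g ** P) $ 2 $ 1 \<in> frac_ideal 0"
    using normalised_basis[OF PQ0] by metis
  define R where "R = (\<lambda>g. Q ** \<rho> g ** P)"
  note G = gram_entries[OF PQ _ _ R_def]
  have Ry: "R y = matrix_2 l1 0 0 l2"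
    unfolding R_def conj by (simp add: diag vector_2)
  have De: "disc (R g) - e g \<in> frac_ideal (n - m)" if g: "g \<in> S" for g
  proof -
    \<comment> \<open>Since \<open>R y\<close> is diagonal, the relation with y has no off-diagonal
      terms. Replacing \<open>e y\<close> by \<open>w\<close> costs a term in \<pi>^n, and dividing
      by \<open>w\<close> then loses m.\<close>
    have "w * disc (R g) - e y * e g \<in> frac_ideal n"
      using G[OF y(1) g] l by (simp add: Ry disc_def vector_2)
    moreover have "(w - e y) * e g \<in> frac_ideal n"
      using frac_ideal_mult[OF we e[OF g]] by simp
    ultimately have "w * (disc (R g) - e g) \<in> frac_ideal n"
      using frac_ideal_diff[of "w * disc (R g) - e y * e g" n "(w - e y) * e g"]
      by (simp add: algebra_simps)
    then show ?thesis
      using frac_ideal_cancel w by blast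
  qed
  have D: "disc (R g) \<in> frac_ideal m" if g: "g \<in> S" for g
    using frac_ideal_add[OF frac_ideal_mono[OF De[OF g], of m] e[OF g]] m by simp
  have b2: "R g $ 1 $ 2 + R x $ 1 $ 2 * R g $ 2 $ 1 \<in> frac_ideal n" if g: "g \<in> S" for g
  proof -
    \<comment> \<open>This sum is D(g) D(x) - e(g) e(x). Each term pairs a factor of valuation at
      least m with one of valuation at least n - m, so only b remains in the relation for g and
      x.\<close>
    have "disc (R g) * (disc (R x) - e x) + (disc (R g) - e g) * e x \<in> frac_ideal n"
      using frac_ideal_mult[OF D[OF g] De[OF x]] frac_ideal_mult[OF De[OF g] e[OF x]]
      by (simp add: frac_ideal_add)
    moreover have "disc (R g) * disc (R x) + 2 * (R g $ 1 $ 2 + R x $ 1 $ 2 * R g $ 2 $ 1) - e g * e x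
        \<in> frac_ideal n"
      using G[OF g x] cx by (simp add: R_def)
    moreover have "2 * (R g $ 1 $ 2 + R x $ 1 $ 2 * R g $ 2 $ 1) =
        (disc (R g) * disc (R x) + 2 * (R g $ 1 $ 2 + R x $ 1 $ 2 * R g $ 2 $ 1) - e g * e x) -
        (disc (R g) * (disc (R x) - e x) + (disc (R g) - e g) * e x)"
      by (simp add: algebra_simps)
    ultimately have "2 * (R g $ 1 $ 2 + R x $ 1 $ 2 * R g $ 2 $ 1) \<in> frac_ideal n"
      using frac_ideal_diff by metis
    then show ?thesis
      by (simp only: twice_iff)
  qed
  have "R x $ 2 $ 1 = 1"
    using cx by (simp add: R_def)
  then have bx: "R x $ 1 $ 2 \<in> frac_ideal n"
    using b2[OF x] twice_iff[of "R x $ 1 $ 2" n] by simp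
  have b: "R g $ 1 $ 2 \<in> frac_ideal n" if g: "g \<in> S" for g
    using frac_ideal_diff[OF b2[OF g] frac_ideal_mult_int[OF bx, of "R g $ 2 $ 1"]] c[OF g]
    by (simp add: R_def)
  show ?thesis
    using that[OF PQ x cx c] b De Ry unfolding R_def by (simp add: vector_2)
qed

end

section \<open>Concrete descriptions of the quotient rings\<close>

context discrete_valuation
begin

definition residue :: "nat \<Rightarrow> 'k \<Rightarrow> 'k set" where
  "residue k x = {y. y - x \<in> frac_ideal k}"

lemma residue_self [simp]: "x \<in> residue k x"
  by (simp add: residue_def)

lemma residue_eq_iff: "residue k x = residue k y \<longleftrightarrow> x - y \<in> frac_ideal k"
proof
  assume "residue k x = residue k y"
  then show "x - y \<in> frac_ideal k"
    using residue_self[of x k] by (simp add: residue_def)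
next
  assume *: "x - y \<in> frac_ideal k"
  have "z - x \<in> frac_ideal k \<longleftrightarrow> z - y \<in> frac_ideal k" for z
    using frac_ideal_add_iff[OF *, of "z - x"] by simp
  then show "residue k x = residue k y"
    by (simp add: residue_def)
qed

lemma int_ring_simps [simp]:
  "carrier (int_ring v) = frac_ideal 0" "x \<otimes>\<^bsub>int_ring v\<^esub> y = x * y" "x \<oplus>\<^bsub>int_ring v\<^esub> y = x + y"
  "\<one>\<^bsub>int_ring v\<^esub> = 1" "\<zero>\<^bsub>int_ring v\<^esub> = 0"
  by (simp_all add: int_ring_def frac_ideal_def)

lemma pow_ideal_eq:
  assumes "uniformiser v p"
  shows "pow_ideal v p k = frac_ideal k"
proof (intro equalityI subsetI)
  have p: "p \<noteq> 0" "v p = 1"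
    using assms by (auto simp: uniformiser_def)
  then have pk: "p ^ k \<noteq> 0" "v (p ^ k) = k"
    by (simp_all add: v_power)
  fix x
  show "x \<in> frac_ideal k" if "x \<in> pow_ideal v p k"
    using that frac_ideal_int_mult[OF _ frac_ideal_v[of "p ^ k"]] pk
    by (auto simp: pow_ideal_def cgenideal_def)
  assume "x \<in> frac_ideal k"
  then have "x / p ^ k \<in> frac_ideal 0"
    using frac_ideal_cancel[of "p ^ k" "x / p ^ k" k] pk by simp
  moreover have "x = x / p ^ k * p ^ k"
    using pk by simp
  ultimately show "x \<in> pow_ideal v p k"
    unfolding pow_ideal_def cgenideal_def int_ring_simps by blast
qed

lemma a_r_coset_int_ring: "frac_ideal (int k) +>\<^bsub>int_ring v\<^esub> x = residue k x"
  by (force simp: a_r_coset_def' residue_def image_iff)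

lemma set_add_int_ring:
  "X <+>\<^bsub>int_ring v\<^esub> Y = {x + y | x y. x \<in> X \<and> y \<in> Y}"
  by (auto simp: set_add_def')

text \<open>Used with \<open>k = n\<close> for addition in the quotient ring and with
  \<open>k \<le> n\<close> for \<open>reduce\<close>.\<close>

lemma set_add_residue:
  assumes "k \<le> n"
  shows "{x + y | x y. x \<in> residue k a \<and> y \<in> residue n b} = residue k (a + b)"
proof (intro equalityI subsetI)
  fix z assume "z \<in> {x + y | x y. x \<in> residue k a \<and> y \<in> residue n b}"
  then obtain x y where "z = x + y" "x - a \<in> frac_ideal k" "y - b \<in> frac_ideal n"
    by (auto simp: residue_def)
  then show "z \<in> residue k (a + b)"
    using frac_ideal_add[of "x - a" k "y - b"] frac_ideal_mono[of "y - b" n k] assms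
    by (simp add: residue_def algebra_simps)
next
  fix z assume "z \<in> residue k (a + b)"
  then have "z - b \<in> residue k a"
    by (simp add: residue_def algebra_simps)
  moreover have "z = (z - b) + b"
    by simp
  ultimately show "z \<in> {x + y | x y. x \<in> residue k a \<and> y \<in> residue n b}"
    using residue_self by blast
qed

context
  fixes p assumes p: "uniformiser v p"
begin

lemma carrier_quot_ring: "carrier (quot_ring v p k) = residue k ` frac_ideal 0"
  by (auto simp: quot_ring_def FactRing_def A_RCOSETS_def' pow_ideal_eq[OF p]
      a_r_coset_int_ring)

lemma one_quot_ring: "\<one>\<^bsub>quot_ring v p k\<^esub> = residue k 1"
  by (simp add: quot_ring_def FactRing_def pow_ideal_eq[OF p] a_r_coset_int_ring)

lemma zero_quot_ring: "\<zero>\<^bsub>quot_ring v p k\<^esub> = residue k 0"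
  by (simp add: quot_ring_def FactRing_def pow_ideal_eq[OF p] residue_def)

lemma add_quot_ring: "residue k x \<oplus>\<^bsub>quot_ring v p k\<^esub> residue k y = residue k (x + y)"
  by (simp add: quot_ring_def FactRing_def set_add_int_ring set_add_residue)

text \<open>The product in \<open>FactRing\<close> is a union over all pairs of representatives; it
  collapses because every pair gives the same coset.\<close>

lemma mult_quot_ring:
  assumes "x \<in> frac_ideal 0" "y \<in> frac_ideal 0"
  shows "residue k x \<otimes>\<^bsub>quot_ring v p k\<^esub> residue k y = residue k (x * y)"
proof -
  have "residue k (a * b) = residue k (x * y)" if "a \<in> residue k x" "b \<in> residue k y" for a b
  proof -
    have d: "a - x \<in> frac_ideal k" "b - y \<in> frac_ideal k"
      using that by (simp_all add: residue_def)
    then have "a \<in> frac_ideal 0"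
      using frac_ideal_diffD[OF frac_ideal_mono[of _ "int k" 0]] assms(1) by simp
    then have "a * (b - y) + (a - x) * y \<in> frac_ideal k"
      using d assms(2) by (simp add: frac_ideal_add frac_ideal_int_mult frac_ideal_mult_int)
    moreover have "a * (b - y) + (a - x) * y = a * b - x * y"
      by (simp add: algebra_simps)
    ultimately show ?thesis
      by (simp add: residue_eq_iff)
  qed
  then have "(\<Union>a\<in>residue k x. \<Union>b\<in>residue k y. residue k (a * b)) = residue k (x * y)"
    using residue_self[of x k] residue_self[of y k] by blast
  then show ?thesis
    by (simp add: quot_ring_def FactRing_def rcoset_mult_def pow_ideal_eq[OF p] a_r_coset_int_ring)
qed

lemma reduce_residue:
  assumes "k \<le> n"
  shows "reduce v p k (residue n x) = residue k x"
  using set_add_residue[OF assms, of 0 x]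
  by (simp add: reduce_def set_add_int_ring pow_ideal_eq[OF p]) (simp add: residue_def)

text \<open>If 2 were in the maximal ideal, then 2 would be the least positive multiple of one that
  vanishes in the residue field, since 1 itself does not vanish.\<close>

lemma two_notin_frac_ideal:
  assumes "ring_char (quot_ring v p 1) \<noteq> 2"
  shows "2 \<notin> frac_ideal 1"
proof
  assume two: "2 \<in> frac_ideal 1"
  let ?R = "quot_ring v p 1"
  define Z where "Z k \<longleftrightarrow> 0 < k \<and> [k] \<cdot>\<^bsub>?R\<^esub> \<one>\<^bsub>?R\<^esub> = \<zero>\<^bsub>?R\<^esub>" for k :: nat
  have nat_mult: "[k] \<cdot>\<^bsub>?R\<^esub> \<one>\<^bsub>?R\<^esub> = residue 1 (of_nat k)" for k :: nat
    by (induction k) (simp_all add: add_pow_def nat_pow_def zero_quot_ring one_quot_ring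
      add_quot_ring add.commute)
  have Z_iff: "Z k \<longleftrightarrow> 0 < k \<and> of_nat k \<in> frac_ideal 1" for k
    unfolding Z_def nat_mult zero_quot_ring residue_eq_iff by simp
  have "Z 2" and "\<not> Z 1"
    unfolding Z_iff using two one_notin_frac_ideal by simp_all
  have "(LEAST k. Z k) = 2"
  proof (rule Least_equality)
    show "Z 2"
      by fact
    fix k assume "Z k"
    then have "k \<noteq> 1" "0 < k"
      using \<open>\<not> Z 1\<close> Z_iff by blast+
    then show "2 \<le> k"
      by linarith
  qed
  then have "ring_char ?R = 2"
    using \<open>Z 2\<close> unfolding ring_char_def Z_def[symmetric] by auto
  with assms show False ..
qed

end

end

section \<open>Lattices and their quotients in coordinates\<close>

lemma abelian_group_subset:
  assumes "abelian_group M" and "H \<subseteq> carrier M" and "\<zero>\<^bsub>M\<^esub> \<in> H"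
    and "\<And>x y. x \<in> H \<Longrightarrow> y \<in> H \<Longrightarrow> x \<oplus>\<^bsub>M\<^esub> y \<in> H"
    and "\<And>x. x \<in> H \<Longrightarrow> \<exists>y\<in>H. y \<oplus>\<^bsub>M\<^esub> x = \<zero>\<^bsub>M\<^esub>"
  shows "abelian_group (M\<lparr>carrier := H\<rparr>)"
proof -
  interpret abelian_group M by fact
  show ?thesis
    by (rule abelian_groupI) (use assms in \<open>auto simp: subset_iff intro: a_assoc a_comm\<close>)
qed

text \<open>Negatives are asked for only as solutions of an addition, the form in which they are
  available for modules of cosets.\<close>

lemma submodule_subset:
  assumes "abelian_group M" and "H \<subseteq> carrier M" and "\<zero>\<^bsub>M\<^esub> \<in> H"
    and add: "\<And>x y. x \<in> H \<Longrightarrow> y \<in> H \<Longrightarrow> x \<oplus>\<^bsub>M\<^esub> y \<in> H"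
    and inv: "\<And>x. x \<in> H \<Longrightarrow> \<exists>y\<in>H. y \<oplus>\<^bsub>M\<^esub> x = \<zero>\<^bsub>M\<^esub>"
    and "\<And>a x. a \<in> carrier R \<Longrightarrow> x \<in> H \<Longrightarrow> a \<odot>\<^bsub>M\<^esub> x \<in> H"
  shows "submodule H R M"
proof -
  interpret abelian_group M by fact
  have "\<ominus>\<^bsub>M\<^esub> x \<in> H" if x: "x \<in> H" for x
  proof -
    obtain y where y: "y \<in> H" "y \<oplus>\<^bsub>M\<^esub> x = \<zero>\<^bsub>M\<^esub>"
      using inv[OF x] by blast
    then have "\<ominus>\<^bsub>M\<^esub> x = y"
      using minus_equality x assms(2) by blast
    with y show ?thesis
      by simp
  qed
  then have "inv\<^bsub>add_monoid M\<^esub> x \<in> H" if "x \<in> H" for x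
    using that by (simp add: a_inv_def)
  with assms show ?thesis
    by (auto intro!: submodule.intro subgroup.intro submodule_axioms.intro)
qed

lemma vec_module_simps [simp]:
  "carrier vec_module = UNIV" "x \<oplus>\<^bsub>vec_module\<^esub> y = x + y" "\<zero>\<^bsub>vec_module\<^esub> = 0"
  "a \<odot>\<^bsub>vec_module\<^esub> x = a *s x"
  by (simp_all add: vec_module_def)

lemma abelian_group_vec_module: "abelian_group (vec_module :: ('k::field, 'k ^ 2) module)"
  by (rule abelian_groupI) (auto simp: add.assoc add.commute intro: exI[of _ "- x" for x])

locale lattice_frame = discrete_valuation v
  for v :: "'k::field \<Rightarrow> int" +
  fixes p :: 'k and P Q :: "'k ^ 2 ^ 2"
  assumes p: "uniformiser v p"
    and QP: "Q ** P = mat 1" and PQ: "P ** Q = mat 1"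
begin

definition coord :: "2 \<Rightarrow> 'k ^ 2 \<Rightarrow> 'k" where
  "coord i z = (Q *v z) $ i"

definition basis :: "2 \<Rightarrow> 'k ^ 2" where
  "basis i = P *v axis i 1"

text \<open>For \<open>k = 0\<close> this is the lattice spanned by the columns of \<open>P\<close>,
  and in general its multiple by \<pi>^k.\<close>

definition lat :: "nat \<Rightarrow> ('k ^ 2) set" where
  "lat k = {z. \<forall>i. coord i z \<in> frac_ideal k}"

definition cls :: "nat \<Rightarrow> 'k ^ 2 \<Rightarrow> ('k ^ 2) set" where
  "cls k z = {y. y - z \<in> lat k}"

lemma coord_linear [simp]:
  "coord i (x + y) = coord i x + coord i y" "coord i (x - y) = coord i x - coord i y"
  "coord i (- x) = - coord i x" "coord i (a *s x) = a * coord i x" "coord i 0 = 0"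
  by (simp_all add: coord_def matrix_vector_mult_def sum_2 algebra_simps)

lemma coord_basis [simp]: "coord i (basis j) = (if i = j then 1 else 0)"
  by (simp add: coord_def basis_def matrix_vector_mul_assoc QP axis_def)

lemma coord_eqI: "(\<And>i. coord i x = coord i y) \<Longrightarrow> x = y"
proof -
  assume "\<And>i. coord i x = coord i y"
  then have "Q *v x = Q *v y"
    by (simp add: coord_def vec_eq_iff)
  then have "P *v (Q *v x) = P *v (Q *v y)"
    by simp
  then show ?thesis
    by (simp add: matrix_vector_mul_assoc PQ)
qed

lemma basis_expansion: "z = coord 1 z *s basis 1 + coord 2 z *s basis 2"
proof (rule coord_eqI)
  fix i :: 2
  show "coord i z = coord i (coord 1 z *s basis 1 + coord 2 z *s basis 2)"
    using exhaust_2[of i] by auto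
qed

lemma coord_matrix:
  "coord i (A *v z) = (Q ** A ** P) $ i $ 1 * coord 1 z + (Q ** A ** P) $ i $ 2 * coord 2 z"
proof -
  have "(Q ** A ** P) *v (Q *v z) = Q ** A *v ((P ** Q) *v z)"
    by (simp only: matrix_vector_mul_assoc matrix_mul_assoc)
  then have "Q *v (A *v z) = (Q ** A ** P) *v (Q *v z)"
    by (simp add: PQ matrix_vector_mul_assoc)
  then show ?thesis
    by (simp add: coord_def) (simp add: matrix_vector_mult_def sum_2)
qed

lemma lat_zero [simp]: "0 \<in> lat k"
  by (simp add: lat_def)

lemma lat_add: "x \<in> lat k \<Longrightarrow> y \<in> lat k \<Longrightarrow> x + y \<in> lat k"
  by (simp add: lat_def frac_ideal_add)

lemma lat_uminus [simp]: "- x \<in> lat k \<longleftrightarrow> x \<in> lat k"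
  by (simp add: lat_def)

lemma lat_diff: "x \<in> lat k \<Longrightarrow> y \<in> lat k \<Longrightarrow> x - y \<in> lat k"
  by (simp add: lat_def frac_ideal_diff)

lemma lat_scale: "a \<in> frac_ideal 0 \<Longrightarrow> x \<in> lat k \<Longrightarrow> a *s x \<in> lat k"
  by (simp add: lat_def frac_ideal_int_mult)

lemma lat_scale': "a \<in> frac_ideal k \<Longrightarrow> x \<in> lat 0 \<Longrightarrow> a *s x \<in> lat k"
  using frac_ideal_mult_int by (simp add: lat_def)

lemma basis_lat [simp]: "basis i \<in> lat 0"
  by (simp add: lat_def)

lemma scale_lat: "(\<lambda>x. p ^ k *s x) ` lat 0 = lat k"
proof (intro equalityI subsetI)
  have pk: "p ^ k \<noteq> 0" "v (p ^ k) = k"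
    using p by (simp_all add: uniformiser_def v_power)
  fix x
  show "x \<in> lat k" if "x \<in> (\<lambda>x. p ^ k *s x) ` lat 0"
    using that lat_scale' frac_ideal_v[of "p ^ k"] pk by auto
  assume x: "x \<in> lat k"
  have "inverse (p ^ k) *s x \<in> lat 0"
    using x frac_ideal_cancel[of "p ^ k" "inverse (p ^ k) * coord i x" k for i] pk
    by (simp add: lat_def mult.assoc[symmetric])
  moreover have "x = p ^ k *s (inverse (p ^ k) *s x)"
    using pk by simp
  ultimately show "x \<in> (\<lambda>x. p ^ k *s x) ` lat 0"
    by blast
qed

lemma cls_self [simp]: "x \<in> cls k x"
  by (simp add: cls_def)

lemma cls_zero: "cls k 0 = lat k"
  by (simp add: cls_def)

lemma cls_eq_iff: "cls k x = cls k y \<longleftrightarrow> x - y \<in> lat k"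
proof
  assume "cls k x = cls k y"
  then show "x - y \<in> lat k"
    using cls_self[of x k] by (simp add: cls_def)
next
  assume *: "x - y \<in> lat k"
  have "z - x \<in> lat k \<longleftrightarrow> z - y \<in> lat k" for z
    using lat_add[OF *, of "z - x"] lat_diff[OF _ *, of "z - y"] by auto
  then show "cls k x = cls k y"
    by (simp add: cls_def)
qed

abbreviation "lat_module \<equiv> vec_module\<lparr>carrier := lat 0\<rparr>"
abbreviation "quot_module k \<equiv> lattice_quot p k (lat 0)"

lemma abelian_group_lat_module: "abelian_group lat_module"
  by (rule abelian_group_subset[OF abelian_group_vec_module])
    (auto simp: lat_add intro: bexI[of _ "- x" for x])

lemma is_lattice_lat: "is_lattice v (lat 0)"
  unfolding is_lattice_def
proof (intro conjI)
  show "submodule (lat 0) (int_ring v) vec_module"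
    by (rule submodule_subset[OF abelian_group_vec_module])
      (auto simp: lat_add lat_scale intro: bexI[of _ "- x" for x])
  show "vec.span (lat 0) = UNIV"
  proof -
    have "z \<in> vec.span (lat 0)" for z
      by (subst basis_expansion) (intro vec.span_add vec.span_scale vec.span_base basis_lat)
    then show ?thesis
      by blast
  qed
  interpret abelian_group lat_module
    by (rule abelian_group_lat_module)
  let ?B = "{basis 1, basis 2}"
  have ne: "basis 1 \<noteq> basis 2"
    using coord_basis[of 1 1] coord_basis[of 1 2] by force
  have fs: "finsum lat_module (\<lambda>b. c b \<odot>\<^bsub>lat_module\<^esub> b) ?B = c (basis 1) *s basis 1 + c (basis 2) *s basis 2"
    if "c \<in> ?B \<rightarrow>\<^sub>E carrier (int_ring v)" for c
    using that ne by (subst finsum_insert)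
      (auto simp: lat_scale PiE_iff)
  have ex1: "\<exists>!c. c \<in> ?B \<rightarrow>\<^sub>E carrier (int_ring v) \<and>
      z = finsum lat_module (\<lambda>b. c b \<odot>\<^bsub>lat_module\<^esub> b) ?B" if z: "z \<in> lat 0" for z
  proof
    \<comment> \<open>The coordinates of \<open>z\<close>, restricted to the basis because
      \<open>free_of_rank\<close> asks for uniqueness among extensional functions.\<close>
    let ?c = "\<lambda>b\<in>?B. if b = basis 1 then coord 1 z else coord 2 z"
    have "?c \<in> ?B \<rightarrow>\<^sub>E carrier (int_ring v)"
      using z by (auto simp: lat_def)
    then show "?c \<in> ?B \<rightarrow>\<^sub>E carrier (int_ring v) \<and>
        z = finsum lat_module (\<lambda>b. ?c b \<odot>\<^bsub>lat_module\<^esub> b) ?B"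
      using fs[of ?c] ne basis_expansion[of z] by auto
    fix c assume c: "c \<in> ?B \<rightarrow>\<^sub>E carrier (int_ring v) \<and>
        z = finsum lat_module (\<lambda>b. c b \<odot>\<^bsub>lat_module\<^esub> b) ?B"
    then have "z = c (basis 1) *s basis 1 + c (basis 2) *s basis 2"
      using fs[of c] by simp
    then have "coord 1 z = c (basis 1)" "coord 2 z = c (basis 2)"
      by simp_all
    then show "c = ?c"
      using c ne by (intro PiE_ext[of c ?B "\<lambda>_. carrier (int_ring v)"])
        (use \<open>?c \<in> ?B \<rightarrow>\<^sub>E carrier (int_ring v)\<close> in auto)
  qed
  show "free_of_rank (int_ring v) lat_module 2"
    unfolding free_of_rank_def using ex1 ne
    by (intro exI[of _ ?B]) auto
qed

lemma quot_module_carrier: "carrier (quot_module k) = cls k ` lat 0"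
  and quot_module_zero: "\<zero>\<^bsub>quot_module k\<^esub> = cls k 0"
  and quot_module_add: "cls k x \<oplus>\<^bsub>quot_module k\<^esub> cls k y = cls k (x + y)"
proof -
  have cos: "lat k +>\<^bsub>lat_module\<^esub> y = cls k y" for y
    by (force simp: a_r_coset_def' cls_def image_iff)
  show "carrier (quot_module k) = cls k ` lat 0"
    by (auto simp: lattice_quot_def fact_module_def scale_lat A_RCOSETS_def' cos)
  show "\<zero>\<^bsub>quot_module k\<^esub> = cls k 0"
    by (simp add: lattice_quot_def fact_module_def scale_lat cls_zero)
  show "cls k x \<oplus>\<^bsub>quot_module k\<^esub> cls k y = cls k (x + y)"
  proof -
    have "\<exists>a b. z = a + b \<and> a - x \<in> lat k \<and> b - y \<in> lat k" if "z - (x + y) \<in> lat k" for z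
      using that by (intro exI[of _ "z - y"] exI[of _ y]) (simp add: diff_diff_eq add.commute)
    moreover have "a + b - (x + y) \<in> lat k" if "a - x \<in> lat k" "b - y \<in> lat k" for a b
      using lat_add[OF that] by (simp add: algebra_simps)
    ultimately show ?thesis
      by (fastforce simp: lattice_quot_def fact_module_def set_add_def' cls_def)
  qed
qed

lemma quot_module_smult:
  assumes "a \<in> frac_ideal 0" "x \<in> lat 0"
  shows "residue k a \<odot>\<^bsub>quot_module k\<^esub> cls k x = cls k (a *s x)"
proof -
  have cos: "lat k +>\<^bsub>lat_module\<^esub> y = cls k y" for y
    by (force simp: a_r_coset_def' cls_def image_iff)
  have "cls k (b *s y) = cls k (a *s x)" if b: "b \<in> residue k a" and y: "y \<in> cls k x" for b y
  proof -
    have "(b - a) *s x \<in> lat k"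
      using b assms(2) lat_scale' unfolding residue_def by blast
    moreover have "b \<in> frac_ideal 0"
      using b assms(1) frac_ideal_diffD[of b a 0] frac_ideal_mono by (fastforce simp: residue_def)
    then have "b *s (y - x) \<in> lat k"
      using y lat_scale unfolding cls_def by blast
    ultimately have "b *s (y - x) + (b - a) *s x \<in> lat k"
      by (rule lat_add[rotated])
    moreover have "b *s (y - x) + (b - a) *s x = b *s y - a *s x"
      by (simp add: vec_eq_iff algebra_simps)
    ultimately show ?thesis
      by (simp add: cls_eq_iff)
  qed
  then have "(\<Union>b\<in>residue k a. \<Union>y\<in>cls k x. cls k (b *s y)) = cls k (a *s x)"
    using residue_self[of a k] cls_self[of x k] by blast
  then show ?thesis
    by (simp add: lattice_quot_def fact_module_def scale_lat cos)
qed

lemma abelian_group_quot_module: "abelian_group (quot_module k)"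
proof (rule abelian_groupI)
  fix X assume "X \<in> carrier (quot_module k)"
  then obtain x where "x \<in> lat 0" "X = cls k x"
    by (auto simp: quot_module_carrier)
  then show "\<exists>Y\<in>carrier (quot_module k). Y \<oplus>\<^bsub>quot_module k\<^esub> X = \<zero>\<^bsub>quot_module k\<^esub>"
    by (intro bexI[of _ "cls k (- x)"])
      (auto simp: quot_module_carrier quot_module_add quot_module_zero)
qed (auto simp: quot_module_carrier quot_module_add quot_module_zero lat_add ac_simps)

definition integral :: "'k ^ 2 ^ 2 \<Rightarrow> bool" where
  "integral A \<longleftrightarrow> (\<forall>i j. (Q ** A ** P) $ i $ j \<in> frac_ideal 0)"

lemma integral_lat: "integral A \<Longrightarrow> z \<in> lat k \<Longrightarrow> A *v z \<in> lat k"
  by (simp add: integral_def lat_def coord_matrix frac_ideal_add frac_ideal_int_mult)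

text \<open>Integrality of \<open>A\<close> gives one inclusion. The image is a whole coset because
  the inverse \<open>B\<close> preserves the lattice too.\<close>

lemma integral_cls:
  assumes "integral A" "integral B" "A ** B = mat 1"
  shows "(\<lambda>x. A *v x) ` cls k x = cls k (A *v x)"
proof (intro equalityI subsetI)
  fix y assume "y \<in> (\<lambda>x. A *v x) ` cls k x"
  then obtain z where "z - x \<in> lat k" "y = A *v z"
    by (auto simp: cls_def)
  then show "y \<in> cls k (A *v x)"
    using integral_lat[OF assms(1)] by (simp add: cls_def flip: matrix_vector_mult_diff_distrib)
next
  fix y assume y: "y \<in> cls k (A *v x)"
  define z where "z = x + B *v (y - A *v x)"
  have "A *v z = A *v x + (A ** B) *v (y - A *v x)"
    by (simp only: z_def matrix_vector_right_distrib matrix_vector_mul_assoc)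
  then have "A *v z = y"
    by (simp add: assms(3))
  moreover have "z \<in> cls k x"
    using integral_lat[OF assms(2)] y by (simp add: cls_def z_def)
  ultimately show "y \<in> (\<lambda>x. A *v x) ` cls k x"
    by blast
qed

end

section \<open>The group action on a stable lattice and its quotients\<close>

locale lattice_rep = lattice_frame v p P Q
  for v :: "'k::field \<Rightarrow> int" and p P Q +
  fixes G :: "('g, 'b) monoid_scheme" and \<rho> :: "'g \<Rightarrow> 'k ^ 2 ^ 2"
  assumes integral_rep: "g \<in> carrier G \<Longrightarrow> integral (\<rho> g)"
    and inverse_rep: "g \<in> carrier G \<Longrightarrow> \<exists>h\<in>carrier G. \<rho> g ** \<rho> h = mat 1"
begin

abbreviation R :: "'g \<Rightarrow> 'k ^ 2 ^ 2" where
  "R g \<equiv> Q ** \<rho> g ** P"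

lemma stable_set_lat: "stable_set G \<rho> (lat 0)"
  using integral_lat integral_rep by (auto simp: stable_set_def)

lemma coset_act_cls: "g \<in> carrier G \<Longrightarrow> coset_act \<rho> g (cls k x) = cls k (\<rho> g *v x)"
  unfolding coset_act_def using integral_cls integral_rep inverse_rep by meson

lemma R_int: "g \<in> carrier G \<Longrightarrow> R g $ i $ j \<in> frac_ideal 0"
  using integral_rep by (simp add: integral_def)

text \<open>Modulo \<pi>^k the matrices are lower triangular, so the second basis vector spans the
  submodule and the first one generates the quotient.\<close>

lemma extension_of_quot_module:
  assumes b: "\<And>g. g \<in> carrier G \<Longrightarrow> R g $ 1 $ 2 \<in> frac_ideal k"
    and a: "\<And>g. g \<in> carrier G \<Longrightarrow> R g $ 1 $ 1 - x\<^sub>1 g \<in> frac_ideal k"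
    and d: "\<And>g. g \<in> carrier G \<Longrightarrow> R g $ 2 $ 2 - x\<^sub>2 g \<in> frac_ideal k"
    and x: "\<And>g. g \<in> carrier G \<Longrightarrow> x\<^sub>1 g \<in> frac_ideal 0" "\<And>g. g \<in> carrier G \<Longrightarrow> x\<^sub>2 g \<in> frac_ideal 0"
    and \<psi>: "\<And>g. g \<in> carrier G \<Longrightarrow> \<psi>\<^sub>1 g = residue k (x\<^sub>1 g)" "\<And>g. g \<in> carrier G \<Longrightarrow> \<psi>\<^sub>2 g = residue k (x\<^sub>2 g)"
  shows "extension_of (quot_ring v p k) (quot_module k) G (coset_act \<rho>) \<psi>\<^sub>1 \<psi>\<^sub>2"
proof -
  \<comment> \<open>Scalars parametrise the line of the second basis vector, faithfully modulo
    \<pi>^k; this yields freeness of rank one.\<close>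
  define w where "w t = cls k (t *s basis 2)" for t
  define W where "W = w ` frac_ideal 0"
  have w_eq_iff: "w s = w t \<longleftrightarrow> s - t \<in> frac_ideal k" for s t
    by (auto simp: w_def cls_eq_iff lat_def)
  have w_add: "w s \<oplus>\<^bsub>quot_module k\<^esub> w t = w (s + t)" for s t
    by (simp add: w_def quot_module_add vec.scale_left_distrib)
  have w_zero: "w 0 = \<zero>\<^bsub>quot_module k\<^esub>"
    by (simp add: w_def quot_module_zero)
  have w_smult: "residue k s \<odot>\<^bsub>quot_module k\<^esub> w t = w (s * t)"
    if "s \<in> frac_ideal 0" "t \<in> frac_ideal 0" for s t
    using that by (simp add: w_def quot_module_smult lat_scale)
  have W_sub: "W \<subseteq> carrier (quot_module k)"
    by (auto simp: W_def w_def quot_module_carrier lat_scale)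
  have W_zero: "\<zero>\<^bsub>quot_module k\<^esub> \<in> W"
    unfolding W_def w_zero[symmetric] by simp
  have W_add: "X \<oplus>\<^bsub>quot_module k\<^esub> Y \<in> W" if "X \<in> W" "Y \<in> W" for X Y
    using that by (auto simp: W_def w_add frac_ideal_add)
  have W_inv: "\<exists>Y\<in>W. Y \<oplus>\<^bsub>quot_module k\<^esub> X = \<zero>\<^bsub>quot_module k\<^esub>" if X: "X \<in> W" for X
  proof -
    obtain t where "t \<in> frac_ideal 0" "X = w t"
      using X by (auto simp: W_def)
    then show ?thesis
      by (intro bexI[of _ "w (- t)"]) (auto simp: W_def w_add w_zero)
  qed
  have "submodule W (quot_ring v p k) (quot_module k)"
    by (rule submodule_subset[OF abelian_group_quot_module W_sub W_zero W_add W_inv])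
      (auto simp: W_def carrier_quot_ring[OF p] w_smult frac_ideal_int_mult)
  moreover have act: "coset_act \<rho> g X = \<psi>\<^sub>2 g \<odot>\<^bsub>quot_module k\<^esub> X"
    if g: "g \<in> carrier G" and X: "X \<in> W" for g X
  proof -
    obtain t where t: "t \<in> frac_ideal 0" "X = w t"
      using X by (auto simp: W_def)
    have "coord i (\<rho> g *v (t *s basis 2) - (x\<^sub>2 g * t) *s basis 2) \<in> frac_ideal k" for i
      using exhaust_2[of i] frac_ideal_mult_int[OF b[OF g] t(1)] frac_ideal_mult_int[OF d[OF g] t(1)]
      by (auto simp: coord_matrix algebra_simps)
    then have "coset_act \<rho> g X = w (x\<^sub>2 g * t)"
      using t by (simp add: w_def coset_act_cls[OF g] cls_eq_iff lat_def del: coord_linear)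
    then show ?thesis
      using t by (simp add: \<psi> g w_smult x)
  qed
  moreover have "coset_act \<rho> g X \<in> W" if "g \<in> carrier G" "X \<in> W" for g X
    using act[OF that] that by (auto simp: W_def \<psi> w_smult x frac_ideal_int_mult)
  ultimately have "stable_submodule (quot_ring v p k) (quot_module k) G (coset_act \<rho>) W"
    by (simp add: stable_submodule_def)
  moreover have "free_of_rank (quot_ring v p k) (quot_module k\<lparr>carrier := W\<rparr>) 1"
  proof -
    let ?M = "quot_module k\<lparr>carrier := W\<rparr>" and ?K = "carrier (quot_ring v p k)"
    interpret abelian_group ?M
      by (rule abelian_group_subset[OF abelian_group_quot_module W_sub W_zero W_add W_inv])
    have w_W: "w t \<in> W" if "t \<in> frac_ideal 0" for t
      using that by (simp add: W_def)
    have fs: "finsum ?M (\<lambda>b. c b \<odot>\<^bsub>?M\<^esub> b) {w 1} = w s"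
      if "c (w 1) = residue k s" "s \<in> frac_ideal 0" for c s
      using that by (subst finsum_insert) (simp_all add: w_W w_smult w_add flip: w_zero)
    have "\<exists>!c. c \<in> {w 1} \<rightarrow>\<^sub>E ?K \<and> X = finsum ?M (\<lambda>b. c b \<odot>\<^bsub>?M\<^esub> b) {w 1}" if "X \<in> W" for X
    proof -
      obtain t where t: "t \<in> frac_ideal 0" "X = w t"
        using \<open>X \<in> W\<close> by (auto simp: W_def)
      show ?thesis
      proof
        show "(\<lambda>b\<in>{w 1}. residue k t) \<in> {w 1} \<rightarrow>\<^sub>E ?K \<and>
            X = finsum ?M (\<lambda>b. (\<lambda>b\<in>{w 1}. residue k t) b \<odot>\<^bsub>?M\<^esub> b) {w 1}"
          using fs[of "\<lambda>b\<in>{w 1}. residue k t" t] t by (auto simp: carrier_quot_ring[OF p])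
        fix c assume c: "c \<in> {w 1} \<rightarrow>\<^sub>E ?K \<and> X = finsum ?M (\<lambda>b. c b \<odot>\<^bsub>?M\<^esub> b) {w 1}"
        then obtain s where s: "c (w 1) = residue k s" "s \<in> frac_ideal 0"
          by (auto simp: PiE_iff carrier_quot_ring[OF p])
        then have "w t = w s"
          using c fs[of c s, OF s] t by simp
        then have "residue k t = residue k s"
          by (simp add: w_eq_iff residue_eq_iff)
        then show "c = (\<lambda>b\<in>{w 1}. residue k t)"
          using c s by (auto simp: fun_eq_iff PiE_iff extensional_def)
      qed
    qed
    then show ?thesis
      unfolding free_of_rank_def using w_W by (intro exI[of _ "{w 1}"]) auto
  qed
  moreover have "W +>\<^bsub>quot_module k\<^esub> coset_act \<rho> g X = W +>\<^bsub>quot_module k\<^esub> (\<psi>\<^sub>1 g \<odot>\<^bsub>quot_module k\<^esub> X)"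
    if g: "g \<in> carrier G" and X: "X \<in> carrier (quot_module k)" for g X
  proof -
    obtain z where z: "z \<in> lat 0" "X = cls k z"
      using X by (auto simp: quot_module_carrier)
    have W_coset: "W +>\<^bsub>quot_module k\<^esub> cls k y = {cls k (t *s basis 2 + y) | t. t \<in> frac_ideal 0}" for y
      by (auto simp: a_r_coset_def' W_def w_def quot_module_add)
    \<comment> \<open>A coset of \<open>W\<close> depends only on the first coordinate modulo
      \<pi>^k, since an integral change of the second coordinate is absorbed into
      \<open>t\<close>.\<close>
    have sub: "{cls k (t *s basis 2 + y) | t. t \<in> frac_ideal 0} \<subseteq>
        {cls k (t *s basis 2 + y') | t. t \<in> frac_ideal 0}"
      if "coord 1 (y - y') \<in> frac_ideal k" "coord 2 (y - y') \<in> frac_ideal 0" for y y'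
    proof clarify
      fix t :: 'k assume t: "t \<in> frac_ideal 0"
      have "coord i (t *s basis 2 + y - ((t + coord 2 (y - y')) *s basis 2 + y')) \<in> frac_ideal k" for i
        using exhaust_2[of i] that(1) by auto
      then have "cls k (t *s basis 2 + y) = cls k ((t + coord 2 (y - y')) *s basis 2 + y')"
        by (simp add: cls_eq_iff lat_def del: coord_linear)
      then show "\<exists>s. cls k (t *s basis 2 + y) = cls k (s *s basis 2 + y') \<and> s \<in> frac_ideal 0"
        using frac_ideal_add[OF t that(2)] by blast
    qed
    let ?y = "\<rho> g *v z" and ?y' = "x\<^sub>1 g *s z"
    have "coord 1 (?y - ?y') = (R g $ 1 $ 1 - x\<^sub>1 g) * coord 1 z + R g $ 1 $ 2 * coord 2 z"
      by (simp add: coord_matrix algebra_simps)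
    then have 1: "coord 1 (?y - ?y') \<in> frac_ideal k"
      using z a[OF g] b[OF g] by (simp add: lat_def frac_ideal_add frac_ideal_mult_int)
    have 2: "coord 2 (?y - ?y') \<in> frac_ideal 0"
      using lat_diff[OF integral_lat[OF integral_rep[OF g] z(1)] lat_scale[OF x(1)[OF g] z(1)]]
      by (simp add: lat_def)
    have 3: "coord 1 (?y' - ?y) \<in> frac_ideal k" "coord 2 (?y' - ?y) \<in> frac_ideal 0"
      using 1 2 frac_ideal_uminus[of "coord i (?y - ?y')" for i] by (simp_all del: frac_ideal_uminus)
    show ?thesis
      unfolding z(2) coset_act_cls[OF g] \<psi>(1)[OF g] quot_module_smult[OF x(1)[OF g] z(1)] W_coset
      by (intro equalityI sub 1 2 3)
  qed
  ultimately show ?thesis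
    unfolding extension_of_def using act by blast
qed

text \<open>Every nonzero stable submodule of the reduction contains the class of the second basis vector,
  so two of them cannot intersect trivially.\<close>

lemma indecomposable_quot_module:
  assumes b: "\<And>g. g \<in> carrier G \<Longrightarrow> R g $ 1 $ 2 \<in> frac_ideal 1"
    and nonsplit: "\<And>t. t \<in> frac_ideal 0 \<Longrightarrow>
      \<exists>g\<in>carrier G. R g $ 2 $ 1 - t * (R g $ 1 $ 1 - R g $ 2 $ 2) \<notin> frac_ideal 1"
  shows "indecomposable (quot_ring v p 1) (quot_module 1) G (coset_act \<rho>)"
proof -
  interpret M: abelian_group "quot_module 1"
    by (rule abelian_group_quot_module)
  have e2: "cls 1 (basis 2) \<noteq> cls 1 0"
    using one_notin_frac_ideal by (auto simp: cls_eq_iff lat_def)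
  have socle: "cls 1 (basis 2) \<in> U"
    if U: "stable_submodule (quot_ring v p 1) (quot_module 1) G (coset_act \<rho>) U"
      and U0: "U \<noteq> {\<zero>\<^bsub>quot_module 1\<^esub>}" for U
  proof -
    interpret submodule U "quot_ring v p 1" "quot_module 1"
      using U by (simp add: stable_submodule_def)
    have add: "cls 1 (x + y) \<in> U" if "cls 1 x \<in> U" "cls 1 y \<in> U" for x y
      using that m_closed[of "cls 1 x" "cls 1 y"] by (simp add: quot_module_add)
    have smult: "cls 1 (a *s x) \<in> U" if "a \<in> frac_ideal 0" "x \<in> lat 0" "cls 1 x \<in> U" for a x
      using that smult_closed[of "residue 1 a" "cls 1 x"] quot_module_smult[of a x 1]
      by (simp add: carrier_quot_ring[OF p])
    have act: "cls 1 (\<rho> g *v x) \<in> U" if "g \<in> carrier G" "cls 1 x \<in> U" for g x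
      using that U by (auto simp: stable_submodule_def simp flip: coset_act_cls)
    have second: "cls 1 (basis 2) \<in> U"
      if y: "y \<in> lat 0" "cls 1 y \<in> U" "coord 1 y \<in> frac_ideal 1" "coord 2 y \<notin> frac_ideal 1" for y
    proof -
      have c: "coord 2 y \<noteq> 0" "v (coord 2 y) = 0"
        using y unit_iff[of "coord 2 y"] by (auto simp: lat_def)
      then have inv: "inverse (coord 2 y) \<in> frac_ideal 0"
        by (simp add: frac_ideal_def v_inverse)
      have "coord i (inverse (coord 2 y) *s y - basis 2) \<in> frac_ideal 1" for i
        using exhaust_2[of i] frac_ideal_int_mult[OF inv y(3)] c by auto
      then have "cls 1 (inverse (coord 2 y) *s y) = cls 1 (basis 2)"
        by (simp add: cls_eq_iff lat_def del: coord_linear)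
      then show ?thesis
        using smult[OF inv y(1,2)] by simp
    qed
    obtain X where "X \<in> U" "X \<noteq> \<zero>\<^bsub>quot_module 1\<^esub>"
      using U0 one_closed by (auto simp: subset_iff)
    moreover from this obtain y where y: "y \<in> lat 0" "X = cls 1 y"
      using subset by (auto simp: quot_module_carrier)
    ultimately have yU: "cls 1 y \<in> U" and y1: "y \<notin> lat 1"
      using cls_eq_iff[of 1 y 0] by (auto simp: quot_module_zero)
    show ?thesis
    proof (cases "coord 1 y \<in> frac_ideal 1")
      case True
      then have "coord 2 y \<notin> frac_ideal 1"
        using y1 by (auto simp: lat_def) (metis exhaust_2)
      then show ?thesis
        using second[OF y(1) yU True] by blast
    next
      case False
      \<comment> \<open>The first coordinate is a unit; dividing by it gives \<open>z\<close> with
        coordinates 1 and \<open>t\<close>.\<close>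
      define r where "r = coord 1 y"
      have r: "r \<noteq> 0" "v r = 0"
        using False y unit_iff[of r] by (auto simp: lat_def r_def)
      then have inv: "inverse r \<in> frac_ideal 0"
        by (simp add: frac_ideal_def v_inverse)
      define z where "z = inverse r *s y"
      define t where "t = coord 2 z"
      have z: "z \<in> lat 0" "cls 1 z \<in> U"
        unfolding z_def using lat_scale[OF inv y(1)] smult[OF inv y(1) yU] by auto
      have z1: "coord 1 z = 1"
        using r by (simp add: z_def r_def)
      have t: "t \<in> frac_ideal 0"
        using z by (simp add: t_def lat_def)
      obtain g where g: "g \<in> carrier G"
        and ns: "R g $ 2 $ 1 - t * (R g $ 1 $ 1 - R g $ 2 $ 2) \<notin> frac_ideal 1"
        using nonsplit[OF t] by blast
      \<comment> \<open>Subtracting the upper left entry times \<open>z\<close> cancels the first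
        coordinate modulo \<pi>. The second coordinate becomes the expression that
        \<open>nonsplit\<close> keeps a unit.\<close>
      define u where "u = \<rho> g *v z + (- R g $ 1 $ 1) *s z"
      have a: "- R g $ 1 $ 1 \<in> frac_ideal 0"
        using R_int[OF g] by simp
      have "u \<in> lat 0"
        unfolding u_def
        by (intro lat_add lat_scale integral_lat integral_rep g z a)
      moreover have "cls 1 u \<in> U"
        unfolding u_def by (intro add act smult g z a)
      moreover have "coord 1 u = R g $ 1 $ 2 * t"
        by (simp add: u_def coord_matrix z1 t_def)
      then have "coord 1 u \<in> frac_ideal 1"
        using frac_ideal_mult_int[OF b[OF g] t] by simp
      moreover have "coord 2 u = R g $ 2 $ 1 - t * (R g $ 1 $ 1 - R g $ 2 $ 2)"
        by (simp add: u_def coord_matrix z1 t_def algebra_simps)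
      then have "coord 2 u \<notin> frac_ideal 1"
        using ns by simp
      ultimately show ?thesis
        by (rule second)
    qed
  qed
  have "carrier (quot_module 1) \<noteq> {\<zero>\<^bsub>quot_module 1\<^esub>}"
    using e2 basis_lat[of 2] unfolding quot_module_carrier quot_module_zero by blast
  moreover have "U = {\<zero>\<^bsub>quot_module 1\<^esub>} \<or> W = {\<zero>\<^bsub>quot_module 1\<^esub>}"
    if "stable_submodule (quot_ring v p 1) (quot_module 1) G (coset_act \<rho>) U"
      "stable_submodule (quot_ring v p 1) (quot_module 1) G (coset_act \<rho>) W"
      "U \<inter> W = {\<zero>\<^bsub>quot_module 1\<^esub>}" for U W
    using socle[OF that(1)] socle[OF that(2)] that(3) e2 unfolding quot_module_zero by blast
  ultimately show ?thesis
    unfolding indecomposable_def by blast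
qed

end

section \<open>The lattice attached to a reducible trace\<close>

text \<open>The image of the identity is an invertible idempotent matrix, hence the identity
  matrix.\<close>

lemma hom_GL2_inverse:
  fixes \<rho> :: "'g \<Rightarrow> 'k::field ^ 2 ^ 2"
  assumes "group G" and \<rho>: "\<rho> \<in> hom G GL2" and g: "g \<in> carrier G"
  shows "\<rho> g ** \<rho> (inv\<^bsub>G\<^esub> g) = mat 1"
proof -
  interpret group G by fact
  have mult: "\<rho> (x \<otimes>\<^bsub>G\<^esub> y) = \<rho> x ** \<rho> y" if "x \<in> carrier G" "y \<in> carrier G" for x y
    using hom_mult[OF \<rho> that] by (simp add: GL2_def)
  have "invertible (\<rho> \<one>\<^bsub>G\<^esub>)"
    using hom_in_carrier[OF \<rho>, of "\<one>\<^bsub>G\<^esub>"] by (simp add: GL2_def)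
  then obtain B where "B ** \<rho> \<one>\<^bsub>G\<^esub> = mat 1"
    unfolding invertible_def by blast
  moreover have "\<rho> \<one>\<^bsub>G\<^esub> ** \<rho> \<one>\<^bsub>G\<^esub> = \<rho> \<one>\<^bsub>G\<^esub>"
    using mult[of "\<one>\<^bsub>G\<^esub>" "\<one>\<^bsub>G\<^esub>"] by simp
  ultimately have "\<rho> \<one>\<^bsub>G\<^esub> = mat 1"
    by (metis matrix_mul_assoc matrix_mul_lid)
  then show ?thesis
    using mult[of g "inv\<^bsub>G\<^esub> g"] g by simp
qed

text \<open>If all these entries vanished, the line spanned by the first column of \<open>P\<close>
  would be a stable proper subspace.\<close>

lemma irreducible_rep_entry:
  fixes \<rho> :: "'g \<Rightarrow> 'k::field ^ 2 ^ 2" and P Q :: "'k ^ 2 ^ 2"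
  assumes irr: "irreducible_rep G \<rho>" and QP: "Q ** P = mat 1" and PQ: "P ** Q = mat 1"
  obtains g where "g \<in> carrier G" "(Q ** \<rho> g ** P) $ 2 $ 1 \<noteq> 0"
proof (rule ccontr)
  assume "\<not> thesis"
  with that have zero: "(Q ** \<rho> g ** P) $ 2 $ 1 = 0" if "g \<in> carrier G" for g
    using that by blast
  define W where "W = {z. (Q *v z) $ 2 = 0}"
  have "vec.subspace W"
    by (auto simp: W_def vec.subspace_def matrix_vector_mult_2 algebra_simps)
      (metis distrib_left mult_zero_right)
  moreover have "\<rho> g *v z \<in> W" if "g \<in> carrier G" "z \<in> W" for g z
  proof -
    have "Q *v (\<rho> g *v z) = (Q ** \<rho> g) *v ((P ** Q) *v z)"
      by (simp add: PQ matrix_vector_mul_assoc)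
    also have "\<dots> = (Q ** \<rho> g ** P) *v (Q *v z)"
      by (simp only: matrix_vector_mul_assoc matrix_mul_assoc)
    finally show ?thesis
      using that zero[OF that(1)] by (simp add: W_def matrix_vector_mult_2[of "Q ** \<rho> g ** P"])
  qed
  ultimately have "W = {0} \<or> W = UNIV"
    using irr unfolding irreducible_rep_def by blast
  moreover have QPx: "Q *v (P *v x) = x" for x
    by (simp add: matrix_vector_mul_assoc QP)
  have "P *v axis 1 1 \<in> W"
    by (simp add: W_def QPx axis_def)
  moreover have "P *v axis 1 1 \<noteq> 0"
    using QPx[of "axis 1 1"] by (metis axis_eq_0_iff matrix_vector_mult_0_right zero_neq_one)
  moreover have "P *v axis 2 1 \<notin> W"
    by (simp add: W_def QPx axis_def)
  ultimately show False
    by blast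
qed

lemma (in discrete_valuation) bounded_on_rep:
  fixes \<rho> :: "'g \<Rightarrow> 'k ^ 2 ^ 2"
  assumes "compact_space T" and "continuous_map T (GL2_topology v) \<rho>"
  shows "bounded_on (topspace T) (\<lambda>g. \<rho> g $ i $ j)"
proof -
  have "continuous_map (GL2_topology v) (valuation_topology v)
      ((\<lambda>f. f (i, j)) \<circ> (\<lambda>A (i, j). A $ i $ j))"
    unfolding GL2_topology_def
    by (intro continuous_map_pullback continuous_map_product_projection) simp
  then have "continuous_map T (valuation_topology v)
      (((\<lambda>f. f (i, j)) \<circ> (\<lambda>A (i, j). A $ i $ j)) \<circ> \<rho>)"
    using assms(2) continuous_map_compose by blast
  then show ?thesis
    using bounded_on_compact_space[OF _ assms(1)] by (simp add: o_def)
qed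

context reducible_trace
begin

text \<open>Joins the two cases. The last conclusion says that modulo \<pi> no line spanned by a
  vector with coordinates (1, t) is stable: since b vanishes there, stability would mean c(g) = t
  D(g) for all g.\<close>

lemma adapted_basis:
  fixes m :: nat
  assumes e: "\<And>g. g \<in> S \<Longrightarrow> e g \<in> frac_ideal m"
    and m: "m < n \<Longrightarrow> \<exists>g\<in>S. e g \<notin> frac_ideal (int m + 1)"
    and "1 \<le> n"
    and s: "s = (if real m < real n / 2 then n - m else nat \<lceil>real n / 2\<rceil>)"
  obtains P Q :: "'k ^ 2 ^ 2" where "Q ** P = mat 1" "P ** Q = mat 1"
    "\<And>g. g \<in> S \<Longrightarrow> (Q ** \<rho> g ** P) $ 2 $ 1 \<in> frac_ideal 0"
    "\<And>g. g \<in> S \<Longrightarrow> (Q ** \<rho> g ** P) $ 1 $ 2 \<in> frac_ideal s"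
    "\<And>g. g \<in> S \<Longrightarrow> disc (Q ** \<rho> g ** P) - e g \<in> frac_ideal s"
    "\<And>t. t \<in> frac_ideal 0 \<Longrightarrow>
      \<exists>g\<in>S. (Q ** \<rho> g ** P) $ 2 $ 1 - t * disc (Q ** \<rho> g ** P) \<notin> frac_ideal 1"
proof -
  have unit: "1 - z \<notin> frac_ideal 1" if "z \<in> frac_ideal 1" for z
    using frac_ideal_diffD[of 1 z 1] that one_notin_frac_ideal by blast
  show ?thesis
  proof (cases "2 * m < n")
    case True
    then have sm: "s = n - m" "int s = int n - int m" "s \<le> n" "1 \<le> s"
      using s by (auto simp: field_simps)
    obtain y where y: "y \<in> S" "e y \<notin> frac_ideal (int m + 1)"
      using m True by auto
    obtain P Q x where PQ: "Q ** P = mat 1" "P ** Q = mat 1" and x: "x \<in> S" "(Q ** \<rho> x ** P) $ 2 $ 1 = 1"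
      and c: "\<And>g. g \<in> S \<Longrightarrow> (Q ** \<rho> g ** P) $ 2 $ 1 \<in> frac_ideal 0"
      and b: "\<And>g. g \<in> S \<Longrightarrow> (Q ** \<rho> g ** P) $ 1 $ 2 \<in> frac_ideal n"
      and D: "\<And>g. g \<in> S \<Longrightarrow> disc (Q ** \<rho> g ** P) - e g \<in> frac_ideal (int n - int m)"
      and cy: "(Q ** \<rho> y ** P) $ 2 $ 1 = 0"
      by (rule adapted_basis_far[OF e y]) (use True in auto)
    have b': "(Q ** \<rho> g ** P) $ 1 $ 2 \<in> frac_ideal s" if "g \<in> S" for g
      using frac_ideal_mono[OF b[OF that], of "int s"] sm by simp
    have D1: "disc (Q ** \<rho> g ** P) - e g \<in> frac_ideal 1" if "g \<in> S" for g
      using frac_ideal_mono[OF D[OF that], of 1] sm by simp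
    have D0: "disc (Q ** \<rho> g ** P) \<in> frac_ideal 0" if "g \<in> S" for g
      using frac_ideal_diffD[OF frac_ideal_mono[OF D1[OF that], of 0] e_int[OF that]] by simp
    have "\<exists>g\<in>S. (Q ** \<rho> g ** P) $ 2 $ 1 - t * disc (Q ** \<rho> g ** P) \<notin> frac_ideal 1"
      if t: "t \<in> frac_ideal 0" for t
    \<comment> \<open>In the first case t D(x) vanishes modulo \<pi>, and x works because c(x) = 1.
      Otherwise t and \<open>e x\<close> are units, so m = 0, and y works because c(y) = 0 and D(y)
      is a unit.\<close>
    proof (cases "t \<in> frac_ideal 1 \<or> e x \<in> frac_ideal 1")
      case True
      then have "t * disc (Q ** \<rho> x ** P) \<in> frac_ideal 1"
        using frac_ideal_mult_int[OF _ D0[OF x(1)]] frac_ideal_int_mult[OF t]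
          frac_ideal_diffD[OF D1[OF x(1)]] by blast
      then show ?thesis
        using x unit by metis
    next
      case False
      then have "m = 0"
        using frac_ideal_mono[OF e[OF x(1)], of 1] by force
      then have "disc (Q ** \<rho> y ** P) \<notin> frac_ideal 1"
        using y frac_ideal_diff[OF _ D1[OF y(1)], of "disc (Q ** \<rho> y ** P)"] by auto
      moreover have "t \<noteq> 0" "v t = 0"
        using False t unit_iff by blast+
      ultimately have "t * disc (Q ** \<rho> y ** P) \<notin> frac_ideal 1"
        using frac_ideal_cancel[of t _ 1] by fastforce
      then show ?thesis
        using y(1) cy by (intro bexI[of _ y]) simp_all
    qed
    then show ?thesis
      using that[OF PQ c b'] D sm by simp
  next
    case False
    then have "\<not> real m < real n / 2"
      by linarith
    then have "s = nat \<lceil>real n / 2\<rceil>"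
      using s by simp
    then have sn: "n \<le> 2 * s" "2 * s \<le> n + 1" "1 \<le> s"
      using \<open>1 \<le> n\<close> by linarith+
    then have "s \<le> m"
      using False by linarith
    then have es: "e g \<in> frac_ideal s" if "g \<in> S" for g
      using frac_ideal_mono[OF e[OF that], of "int s"] by simp
    obtain P Q x where PQ: "Q ** P = mat 1" "P ** Q = mat 1" and x: "x \<in> S" "(Q ** \<rho> x ** P) $ 2 $ 1 = 1"
      and c: "\<And>g. g \<in> S \<Longrightarrow> (Q ** \<rho> g ** P) $ 2 $ 1 \<in> frac_ideal 0"
      and b: "\<And>g. g \<in> S \<Longrightarrow> (Q ** \<rho> g ** P) $ 1 $ 2 \<in> frac_ideal s"
      and D: "\<And>g. g \<in> S \<Longrightarrow> disc (Q ** \<rho> g ** P) - e g \<in> frac_ideal s"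
      by (rule adapted_basis_close[OF es]) (use sn in auto)
    have "disc (Q ** \<rho> x ** P) \<in> frac_ideal 1"
      using frac_ideal_mono[OF frac_ideal_diffD[OF D[OF x(1)] es[OF x(1)]], of 1] sn by simp
    then have "\<exists>g\<in>S. (Q ** \<rho> g ** P) $ 2 $ 1 - t * disc (Q ** \<rho> g ** P) \<notin> frac_ideal 1"
      if "t \<in> frac_ideal 0" for t
      using x unit frac_ideal_int_mult[OF that] by metis
    then show ?thesis
      using that[OF PQ c b D] by simp
  qed
qed

end

section \<open>From characters with values in cosets to congruences in the field, and construction
  of the lattice\<close>

theorem theorem1p5:
  fixes v :: "'k::field \<Rightarrow> int"
    and \<pi> :: 'k
    and G :: "('g, 'b) monoid_scheme"
    and T :: "'g topology"
    and \<rho> :: "'g \<Rightarrow> 'k ^ 2 ^ 2"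
    and n s :: nat
    and \<chi>\<^sub>1 \<chi>\<^sub>2 :: "'g \<Rightarrow> 'k set"
  assumes "complete_discrete_valuation v"
    and "uniformiser v \<pi>"
    and "ring_char (quot_ring v \<pi> 1) \<noteq> 2"
    and "compact_group G T"
    and "\<rho> \<in> hom G GL2"
    and "continuous_map T (GL2_topology v) \<rho>"
    and "irreducible_rep G \<rho>"
    and "1 \<le> n"
    and "\<chi>\<^sub>1 \<in> hom G (units_of (quot_ring v \<pi> n))"
    and "\<chi>\<^sub>2 \<in> hom G (units_of (quot_ring v \<pi> n))"
    and "\<And>g. g \<in> carrier G \<Longrightarrow>
           trace (\<rho> g) \<in> carrier (int_ring v) \<and>
           pow_ideal v \<pi> n +>\<^bsub>int_ring v\<^esub> trace (\<rho> g) = \<chi>\<^sub>1 g \<oplus>\<^bsub>quot_ring v \<pi> n\<^esub> \<chi>\<^sub>2 g"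
    and "s = extension_depth v \<pi> n G \<chi>\<^sub>1 \<chi>\<^sub>2"
  shows "\<exists>\<Lambda>. is_lattice v \<Lambda> \<and> stable_set G \<rho> \<Lambda> \<and>
    extension_of (quot_ring v \<pi> s) (lattice_quot \<pi> s \<Lambda>) G (coset_act \<rho>)
      (\<lambda>g. reduce v \<pi> s (\<chi>\<^sub>1 g)) (\<lambda>g. reduce v \<pi> s (\<chi>\<^sub>2 g)) \<and>
    indecomposable (quot_ring v \<pi> 1) (lattice_quot \<pi> 1 \<Lambda>) G (coset_act \<rho>)"
proof -
  interpret complete_discrete_valuation v by fact
  interpret compact_group G T by fact
  note \<pi> = \<open>uniformiser v \<pi>\<close>
  have two: "2 \<notin> frac_ideal 1"
    using two_notin_frac_ideal[OF \<pi>] assms(3) .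
  \<comment> \<open>Chooses integral representatives of the character values; they are
    multiplicative only modulo \<pi>^n.\<close>
  have lift: "\<exists>x. \<forall>g\<in>carrier G. x g \<in> frac_ideal 0 \<and> \<psi> g = residue n (x g)"
    if \<psi>: "\<psi> \<in> hom G (units_of (quot_ring v \<pi> n))" for \<psi>
  proof -
    have "\<forall>g\<in>carrier G. \<exists>x. x \<in> frac_ideal 0 \<and> \<psi> g = residue n x"
      using hom_in_carrier[OF \<psi>] by (force simp: units_of_def Units_def carrier_quot_ring[OF \<pi>])
    then show "\<exists>x. \<forall>g\<in>carrier G. x g \<in> frac_ideal 0 \<and> \<psi> g = residue n (x g)"
      by (rule bchoice)
  qed
  obtain x\<^sub>1 where x\<^sub>1: "\<And>g. g \<in> carrier G \<Longrightarrow> x\<^sub>1 g \<in> frac_ideal 0"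
    "\<And>g. g \<in> carrier G \<Longrightarrow> \<chi>\<^sub>1 g = residue n (x\<^sub>1 g)"
    using lift[OF assms(9)] by blast
  obtain x\<^sub>2 where x\<^sub>2: "\<And>g. g \<in> carrier G \<Longrightarrow> x\<^sub>2 g \<in> frac_ideal 0"
    "\<And>g. g \<in> carrier G \<Longrightarrow> \<chi>\<^sub>2 g = residue n (x\<^sub>2 g)"
    using lift[OF assms(10)] by blast
  have hom1: "x\<^sub>1 (g \<otimes>\<^bsub>G\<^esub> h) - x\<^sub>1 g * x\<^sub>1 h \<in> frac_ideal n"
    and hom2: "x\<^sub>2 (g \<otimes>\<^bsub>G\<^esub> h) - x\<^sub>2 g * x\<^sub>2 h \<in> frac_ideal n"
    if "g \<in> carrier G" "h \<in> carrier G" for g h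
    using hom_mult[OF assms(9) that] hom_mult[OF assms(10) that] that
    by (simp_all add: units_of_def x\<^sub>1 x\<^sub>2 mult_quot_ring[OF \<pi>] residue_eq_iff)
  have tr: "trace (\<rho> g) - (x\<^sub>1 g + x\<^sub>2 g) \<in> frac_ideal n" if "g \<in> carrier G" for g
    using assms(11)[OF that] that
    by (simp add: x\<^sub>1 x\<^sub>2 add_quot_ring[OF \<pi>] pow_ideal_eq[OF \<pi>] a_r_coset_int_ring residue_eq_iff)
  have tr_int: "trace (\<rho> g) \<in> frac_ideal 0" if "g \<in> carrier G" for g
    using assms(11)[OF that] by simp
  define e where "e g = x\<^sub>1 g - x\<^sub>2 g" for g
  have rho_mult: "\<rho> (g \<otimes>\<^bsub>G\<^esub> h) = \<rho> g ** \<rho> h" if "g \<in> carrier G" "h \<in> carrier G" for g h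
    using hom_mult[OF assms(5) that] by (simp add: GL2_def)
  interpret reducible_trace v "carrier G" \<rho> e n
  proof
    show "2 \<notin> frac_ideal 1"
      by (rule two)
    show "e g \<in> frac_ideal 0" if "g \<in> carrier G" for g
      using x\<^sub>1 x\<^sub>2 that by (simp add: e_def frac_ideal_diff)
  next
    fix P Q :: "'k ^ 2 ^ 2" assume PQ: "Q ** P = mat 1" "P ** Q = mat 1"
    obtain g where g: "g \<in> carrier G" "(Q ** \<rho> g ** P) $ 2 $ 1 \<noteq> 0"
      using irreducible_rep_entry[OF assms(7) PQ] .
    have "bounded_on (carrier G) (\<lambda>g. (Q ** \<rho> g ** P) $ 2 $ 1)"
      unfolding matrix_mult_2
      by (intro bounded_on_add bounded_on_mult bounded_on_const
        bounded_on_rep[OF compact assms(6), unfolded topspace_eq])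
    then obtain x where "x \<in> carrier G" "(Q ** \<rho> x ** P) $ 2 $ 1 \<noteq> 0"
      "\<And>z. z \<in> carrier G \<Longrightarrow> (Q ** \<rho> z ** P) $ 2 $ 1 / (Q ** \<rho> x ** P) $ 2 $ 1 \<in> frac_ideal 0"
      by (rule bounded_on_minimum[where f = "\<lambda>g. (Q ** \<rho> g ** P) $ 2 $ 1", OF _ g]) (rule that)
    then show "\<exists>x\<in>carrier G. (Q ** \<rho> x ** P) $ 2 $ 1 \<noteq> 0 \<and>
        (\<forall>g\<in>carrier G. (Q ** \<rho> g ** P) $ 2 $ 1 / (Q ** \<rho> x ** P) $ 2 $ 1 \<in> frac_ideal 0)"
      by blast
  next
    fix g h assume g: "g \<in> carrier G" and h: "h \<in> carrier G"
    let ?t = "\<lambda>g. trace (\<rho> g) - (x\<^sub>1 g + x\<^sub>2 g)"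
    \<comment> \<open>This telescopes to the trace of \<open>\<rho> g ** \<rho> h\<close> minus the
      products of the values of \<open>x\<^sub>1\<close> and of \<open>x\<^sub>2\<close> at g and h.
      Doubling it and using 2(pp' + qq') - (p + q)(p' + q') = (p - q)(p' - q') produces
      \<open>e g * e h\<close>.\<close>
    let ?d = "?t (g \<otimes>\<^bsub>G\<^esub> h) + (x\<^sub>1 (g \<otimes>\<^bsub>G\<^esub> h) - x\<^sub>1 g * x\<^sub>1 h) + (x\<^sub>2 (g \<otimes>\<^bsub>G\<^esub> h) - x\<^sub>2 g * x\<^sub>2 h)"
    have d: "?d \<in> frac_ideal n"
      by (intro frac_ideal_add tr hom1 hom2 g h m_closed)
    have t: "?t g * trace (\<rho> h) \<in> frac_ideal n" "(x\<^sub>1 g + x\<^sub>2 g) * ?t h \<in> frac_ideal n"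
      using frac_ideal_mult_int[OF tr[OF g] tr_int[OF h]]
        frac_ideal_int_mult[OF frac_ideal_add[OF x\<^sub>1(1)[OF g] x\<^sub>2(1)[OF g]] tr[OF h]] .
    have "?d + ?d - ?t g * trace (\<rho> h) - (x\<^sub>1 g + x\<^sub>2 g) * ?t h \<in> frac_ideal n"
      using frac_ideal_diff[OF frac_ideal_diff[OF frac_ideal_add[OF d d] t(1)] t(2)] .
    also have "?d + ?d - ?t g * trace (\<rho> h) - (x\<^sub>1 g + x\<^sub>2 g) * ?t h =
        2 * trace (\<rho> g ** \<rho> h) - trace (\<rho> g) * trace (\<rho> h) - e g * e h"
      unfolding e_def rho_mult[OF g h, symmetric] by (simp add: algebra_simps)
    finally show "2 * trace (\<rho> g ** \<rho> h) - trace (\<rho> g) * trace (\<rho> h) - e g * e h \<in> frac_ideal n" .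
  qed
  define m where "m = congruence_depth v \<pi> n G \<chi>\<^sub>1 \<chi>\<^sub>2"
  define C where "C j \<longleftrightarrow> j \<le> n \<and> (\<forall>g\<in>carrier G. reduce v \<pi> j (\<chi>\<^sub>1 g) = reduce v \<pi> j (\<chi>\<^sub>2 g))" for j
  have C_iff: "C j \<longleftrightarrow> j \<le> n \<and> (\<forall>g\<in>carrier G. e g \<in> frac_ideal j)" for j
    by (simp add: C_def e_def x\<^sub>1(2) x\<^sub>2(2) reduce_residue[OF \<pi>] residue_eq_iff
        cong: conj_cong ball_cong)
  have C0: "C 0"
    by (simp add: C_iff e_int)
  have bound: "\<And>j. C j \<Longrightarrow> j \<le> n"
    by (simp add: C_iff)
  have m_def': "m = (GREATEST j. C j)"
    by (simp add: m_def congruence_depth_def C_def)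
  have Cm: "C m"
    unfolding m_def' using C0 bound by (rule GreatestI_nat)
  have em: "e g \<in> frac_ideal m" if "g \<in> carrier G" for g
    using Cm that by (simp add: C_iff)
  \<comment> \<open>At \<open>m = n\<close> the maximum is cut off by the bound n, so a witness is
    claimed only below n.\<close>
  have m_max: "\<exists>g\<in>carrier G. e g \<notin> frac_ideal (int m + 1)" if "m < n"
  proof (rule ccontr)
    assume "\<not> ?thesis"
    then have "C (Suc m)"
      using \<open>m < n\<close> by (simp add: C_iff add.commute)
    then have "Suc m \<le> m"
      unfolding m_def' using bound by (rule Greatest_le_nat)
    then show False
      by simp
  qed
  have s_eq: "s = (if real m < real n / 2 then n - m else nat \<lceil>real n / 2\<rceil>)"
    by (simp add: assms(12) extension_depth_def m_def)
  obtain P Q :: "'k ^ 2 ^ 2" where PQ: "Q ** P = mat 1" "P ** Q = mat 1"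
    and c: "\<And>g. g \<in> carrier G \<Longrightarrow> (Q ** \<rho> g ** P) $ 2 $ 1 \<in> frac_ideal 0"
    and b: "\<And>g. g \<in> carrier G \<Longrightarrow> (Q ** \<rho> g ** P) $ 1 $ 2 \<in> frac_ideal s"
    and D: "\<And>g. g \<in> carrier G \<Longrightarrow> disc (Q ** \<rho> g ** P) - e g \<in> frac_ideal s"
    and nonsplit: "\<And>t. t \<in> frac_ideal 0 \<Longrightarrow>
      \<exists>g\<in>carrier G. (Q ** \<rho> g ** P) $ 2 $ 1 - t * disc (Q ** \<rho> g ** P) \<notin> frac_ideal 1"
    by (rule adapted_basis[OF em m_max \<open>1 \<le> n\<close> s_eq], assumption+) (rule that)
  have s: "1 \<le> s" "s \<le> n"
    using \<open>1 \<le> n\<close> unfolding s_eq by (auto simp: field_simps) linarith+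
  have tr_s: "trace (Q ** \<rho> g ** P) - (x\<^sub>1 g + x\<^sub>2 g) \<in> frac_ideal s" if "g \<in> carrier G" for g
    using frac_ideal_mono[OF tr[OF that], of "int s"] s by (simp add: trace_conjugate PQ)
  have a: "(Q ** \<rho> g ** P) $ 1 $ 1 - x\<^sub>1 g \<in> frac_ideal s"
    and d: "(Q ** \<rho> g ** P) $ 2 $ 2 - x\<^sub>2 g \<in> frac_ideal s" if g: "g \<in> carrier G" for g
  proof -
    \<comment> \<open>Trace and diagonal difference are both known modulo \<pi>^s; as 2 is a unit,
      they determine the diagonal entries.\<close>
    have "2 * ((Q ** \<rho> g ** P) $ 1 $ 1 - x\<^sub>1 g) =
        (trace (Q ** \<rho> g ** P) - (x\<^sub>1 g + x\<^sub>2 g)) + (disc (Q ** \<rho> g ** P) - e g)"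
      "2 * ((Q ** \<rho> g ** P) $ 2 $ 2 - x\<^sub>2 g) =
        (trace (Q ** \<rho> g ** P) - (x\<^sub>1 g + x\<^sub>2 g)) - (disc (Q ** \<rho> g ** P) - e g)"
      by (simp_all add: trace_2 disc_def e_def algebra_simps)
    then show "(Q ** \<rho> g ** P) $ 1 $ 1 - x\<^sub>1 g \<in> frac_ideal s"
        "(Q ** \<rho> g ** P) $ 2 $ 2 - x\<^sub>2 g \<in> frac_ideal s"
      using frac_ideal_add[OF tr_s[OF g] D[OF g]] frac_ideal_diff[OF tr_s[OF g] D[OF g]]
      by (metis twice_iff)+
  qed
  interpret F: lattice_frame v \<pi> P Q
    by unfold_locales (use \<pi> PQ in auto)
  interpret F: lattice_rep v \<pi> P Q G \<rho>
  proof
    fix g assume g: "g \<in> carrier G"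
    have "(Q ** \<rho> g ** P) $ 1 $ 1 \<in> frac_ideal 0" "(Q ** \<rho> g ** P) $ 2 $ 2 \<in> frac_ideal 0"
      using frac_ideal_diffD[OF frac_ideal_mono[OF a[OF g], of 0] x\<^sub>1(1)[OF g]]
        frac_ideal_diffD[OF frac_ideal_mono[OF d[OF g], of 0] x\<^sub>2(1)[OF g]] by simp_all
    then show "F.integral (\<rho> g)"
      using c[OF g] frac_ideal_mono[OF b[OF g], of 0] by (simp add: F.integral_def forall_2)
    show "\<exists>h\<in>carrier G. \<rho> g ** \<rho> h = mat 1"
      using hom_GL2_inverse[OF is_group assms(5) g] g by blast
  qed
  have "extension_of (quot_ring v \<pi> s) (lattice_quot \<pi> s (F.lat 0)) G (coset_act \<rho>)
      (\<lambda>g. reduce v \<pi> s (\<chi>\<^sub>1 g)) (\<lambda>g. reduce v \<pi> s (\<chi>\<^sub>2 g))"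
    using s by (intro F.extension_of_quot_module[OF b a d x\<^sub>1(1) x\<^sub>2(1)])
      (auto simp: x\<^sub>1(2) x\<^sub>2(2) reduce_residue[OF \<pi>])
  moreover have "indecomposable (quot_ring v \<pi> 1) (lattice_quot \<pi> 1 (F.lat 0)) G (coset_act \<rho>)"
  proof (rule F.indecomposable_quot_module)
    show "(Q ** \<rho> g ** P) $ 1 $ 2 \<in> frac_ideal 1" if "g \<in> carrier G" for g
      using frac_ideal_mono[OF b[OF that], of 1] s by simp
  qed (use nonsplit in \<open>simp add: disc_def\<close>)
  ultimately show ?thesis
    using F.is_lattice_lat F.stable_set_lat by blast
qed

end
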